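(* Let $\beta,Q\in(0,\infty)$ and $p\in[1,\infty]$. Consider the Gaussian white noise model and the estimator $\widetilde f=\widetilde f_n$ (which depends on $\beta$ and $Q$) defined by $$\widetilde d_{j,k}:=\operatorname{sign}(Y_{j,k})\big(|Y_{j,k}|\wedge Q2^{-\frac j2(2\beta+1)}\big),\qquad \widetilde f:=\sum_{j=-1}^{J_n}\sum_{k\in I_j}\widetilde d_{j,k}\,\psi_{j,k},$$ where $J_n=J_n(\beta)$ is an integer sequence with $2^{J_n}\asymp n^{1/(2\beta+1)}$. Then $\widetilde f$ attains the minimax rate for $L^p$-loss over $\Theta(\beta,Q)$, that is, $$\limsup_{n\to\infty}\ r_{n,p}^{-1}\sup_{f\in\Theta(\beta,Q)}\mathbb{E}_f\big[\|\widetilde f-f\|_p\big]<\infty,$$ where $r_{n,p}=n^{-\beta/(2\beta+1)}$ if $1\le p<\infty$ and $r_{n,\infty}=(n/\log n)^{-\beta/(2\beta+1)}$ is the minimax rate.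
   Context: Model: one observes $(Y_t)_{t\in[0,1]}$ with $dY_t=f(t)\,dt+n^{-1/2}dW_t$, $W$ a Brownian motion; $\mathbb{P}_f,\mathbb{E}_f$ denote probability and expectation under regression function $f$. $\|\cdot\|_p$ is the $L^p$-norm on $[0,1]$. Wavelets: $(\phi,\psi)$ is a scaling and wavelet function generating an orthonormal wavelet basis $\{\psi_{j,k}: j\ge -1,\ k\in I_j\}$ of $L^2[0,1]$, where $\psi_{-1,k}=\phi(\cdot-k)$ and $\psi_{j,k}=2^{j/2}\psi(2^j\cdot-k)$ for $j\ge 0$ (near the endpoints of $[0,1]$ one uses the boundary-adapted functions of the Cohen–Daubechies–Vial construction). The basis is $s$-regular: $\phi,\psi$ have compact support and are $s$-times continuously differentiable. $I_j$ is the finite set of indices on resolution level $j$, and $|I_j|\asymp 2^j$. There is a constant $C$ independent of $p$ with $\|\sum_{j\ge-1}\sum_{k\in I_j}d_{j,k}\psi_{j,k}\|_p\le C\sum_{j\ge-1}2^{j(\frac12-\frac1p)}\|(d_{j,k})_{k\in I_j}\|_{\ell^p}$ for all $1\le p\le\infty$. For $f\in L^2[0,1]$, $d_{j,k}=\int f\psi_{j,k}$. The empirical wavelet coefficients are $Y_{j,k}=\int\psi_{j,k}(u)\,dY_u=d_{j,k}+n^{-1/2}\epsilon_{j,k}$, with $(\epsilon_{j,k})$ i.i.d. standard normal. Parameter space: $\Theta(\beta,Q)=\{f=\sum_{j=-1}^\infty\sum_{k\in I_j}d_{j,k}\psi_{j,k}:\ |d_{j,k}|\le Q2^{-\frac j2(2\beta+1)}\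 \text{for all } j\ge-1,\ k\in I_j\}$. $a_n\asymp b_n$ means $a_n/b_n$ is bounded above and below by positive constants; $a\wedge b=\min(a,b)$. *)

theory Defs
  imports "HOL-Probability.Probability" "HOL-Library.Landau_Symbols"
begin

section \<open>Norms and orthonormal bases\<close>

text \<open>
  The exponent ranges over \<open>1 \<le> p \<le> \<infinity>\<close>, hence its type \<^typ>\<open>ennreal\<close>. With a counting
  measure this is the \<open>\<ell>\<^sup>p\<close>-norm. The convention \<open>1/\<infinity> = 0\<close> is built into
  \<open>inv_exponent\<close>, since \<open>inverse \<infinity> = 0\<close> in \<^typ>\<open>ennreal\<close>.
\<close>

definition Lp_norm :: "'a measure \<Rightarrow> ennreal \<Rightarrow> ('a \<Rightarrow> real) \<Rightarrow> ennreal" where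
  "Lp_norm M p f =
     (if p = \<infinity> then esssup M (\<lambda>x. ennreal \<bar>f x\<bar>)
      else let I = (\<integral>\<^sup>+ x. ennreal (\<bar>f x\<bar> powr enn2real p) \<partial>M)
           in if I = \<infinity> then \<infinity> else ennreal (enn2real I powr (1 / enn2real p)))"

definition inv_exponent :: "ennreal \<Rightarrow> real" where
  "inv_exponent p = enn2real (inverse p)"

definition square_integrable :: "'a measure \<Rightarrow> ('a \<Rightarrow> real) set" where
  "square_integrable M = {f \<in> borel_measurable M. integrable M (\<lambda>x. (f x)\<^sup>2)}"

abbreviation unit_interval :: "real measure" where
  "unit_interval \<equiv> lebesgue_on {0..1}"

definition orthonormal_basis :: "'a measure \<Rightarrow> 'i set \<Rightarrow> ('i \<Rightarrow> 'a \<Rightarrow> real) \<Rightarrow> bool" where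
  "orthonormal_basis M A e \<longleftrightarrow>
     (\<forall>i\<in>A. e i \<in> square_integrable M) \<and>
     (\<forall>i\<in>A. \<forall>j\<in>A. (\<integral>x. e i x * e j x \<partial>M) = (if i = j then 1 else 0)) \<and>
     (\<forall>f\<in>square_integrable M. (\<forall>i\<in>A. (\<integral>x. f x * e i x \<partial>M) = 0) \<longrightarrow> (AE x in M. f x = 0))"


section \<open>Wavelet bases of the unit interval\<close>

definition cont_diff :: "nat \<Rightarrow> (real \<Rightarrow> real) \<Rightarrow> bool" where
  "cont_diff s f \<longleftrightarrow>
     (\<exists>D :: nat \<Rightarrow> real \<Rightarrow> real. D 0 = f \<and>
        (\<forall>i<s. \<forall>x. (D i has_real_derivative D (Suc i) x) (at x)) \<and>
        continuous_on UNIV (D s))"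

definition compactly_supported :: "(real \<Rightarrow> real) \<Rightarrow> bool" where
  "compactly_supported f \<longleftrightarrow> (\<exists>R. \<forall>x. \<bar>x\<bar> > R \<longrightarrow> f x = 0)"

definition dilate :: "(real \<Rightarrow> real) \<Rightarrow> (real \<Rightarrow> real) \<Rightarrow> int \<Rightarrow> int \<Rightarrow> real \<Rightarrow> real" where
  "dilate \<phi> \<psi> j k x =
     (if j = -1 then \<phi> (x - of_int k)
      else 2 powr (of_int j / 2) * \<psi> (2 powr of_int j * x - of_int k))"

definition scaling_span :: "(real \<Rightarrow> real) \<Rightarrow> nat \<Rightarrow> (real \<Rightarrow> real) set" where
  "scaling_span \<phi> m =
     {g. \<exists>(N :: int set) c. finite N \<and> g = (\<lambda>x. \<Sum>n\<in>N. c n * \<phi> (2 ^ m * x - of_int n))}"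

text \<open>
  Membership in \<open>scaling_span \<phi> 1\<close> is the two-scale relation; its sum is finite because of
  the compact supports.
\<close>

definition wavelet_pair :: "nat \<Rightarrow> (real \<Rightarrow> real) \<Rightarrow> (real \<Rightarrow> real) \<Rightarrow> bool" where
  "wavelet_pair s \<phi> \<psi> \<longleftrightarrow>
     compactly_supported \<phi> \<and> compactly_supported \<psi> \<and>
     cont_diff s \<phi> \<and> cont_diff s \<psi> \<and>
     \<phi> \<in> scaling_span \<phi> 1 \<and>
     \<psi> \<in> scaling_span \<phi> 1 \<and>
     orthonormal_basis lebesgue ({-1..} \<times> UNIV) (\<lambda>(j, k). dilate \<phi> \<psi> j k)"

text \<open>
  Structure of the Cohen--Daubechies--Vial basis relative to \<open>(\<phi>, \<psi>)\<close>. From a level \<open>j0\<close>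
  on, a basis function is either an interior wavelet, supported in \<open>[0,1]\<close>, or the
  dilation towards one of the endpoints of one of finitely many boundary wavelets. The
  latter are finite combinations of the \<open>\<phi> (2 x - n)\<close>, used on \<open>[0,\<infinity>)\<close> at the endpoint \<open>0\<close>
  and on \<open>(-\<infinity>,0]\<close> at the endpoint \<open>1\<close>. On the finitely many levels below \<open>j0\<close> the interval
  is too short, compared with the supports of \<open>\<phi>\<close> and \<open>\<psi>\<close>, to separate the two endpoints.
  There all functions are adapted to the boundary and lie in the span of the restrictions
  to \<open>[0,1]\<close> of the scaling functions of level \<open>j0\<close>.
\<close>

definition boundary_adapted ::
  "(real \<Rightarrow> real) \<Rightarrow> (real \<Rightarrow> real) \<Rightarrow> (int \<Rightarrow> int set) \<Rightarrow> (int \<Rightarrow> int \<Rightarrow> real \<Rightarrow> real) \<Rightarrow> bool" where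
  "boundary_adapted \<phi> \<psi> I w \<longleftrightarrow>
     (\<exists>(j0 :: nat) G. finite G \<and> G \<subseteq> scaling_span \<phi> 1 \<and>
        (\<forall>j \<ge> int j0. \<forall>k\<in>I j.
           ((\<forall>x\<in>{0..1}. w j k x = dilate \<phi> \<psi> j k x) \<and>
            (\<forall>x. x \<notin> {0..1} \<longrightarrow> dilate \<phi> \<psi> j k x = 0)) \<or>
           (\<exists>g\<in>G. \<forall>x\<in>{0..1}. w j k x = 2 powr (of_int j / 2) * g (2 powr of_int j * x)) \<or>
           (\<exists>g\<in>G. \<forall>x\<in>{0..1}. w j k x = 2 powr (of_int j / 2) * g (2 powr of_int j * (x - 1)))) \<and>
        (\<forall>j\<in>{-1..<int j0}. \<forall>k\<in>I j. \<exists>g\<in>scaling_span \<phi> j0. \<forall>x\<in>{0..1}. w j k x = g x))"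

text \<open>\<open>f\<close> is the sum, in \<open>L\<^sup>2[0,1]\<close>, of the wavelet series with coefficients \<open>d\<close>.\<close>

definition wavelet_series ::
  "(int \<Rightarrow> int set) \<Rightarrow> (int \<Rightarrow> int \<Rightarrow> real \<Rightarrow> real) \<Rightarrow> (int \<Rightarrow> int \<Rightarrow> real) \<Rightarrow> (real \<Rightarrow> real) \<Rightarrow> bool" where
  "wavelet_series I w d f \<longleftrightarrow>
     f \<in> square_integrable unit_interval \<and>
     (\<lambda>J :: nat. Lp_norm unit_interval 2
        (\<lambda>x. f x - (\<Sum>j\<in>{-1..int J}. \<Sum>k\<in>I j. d j k * w j k x))) \<longlonglongrightarrow> 0"

text \<open>
  In the norm inequality the sum over \<open>j \<ge> -1\<close> is written with \<open>j = int i - 1\<close>. It is a sum in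
  \<^typ>\<open>ennreal\<close>, so a divergent right-hand side gives the trivial bound.
\<close>

definition interval_wavelet_basis ::
  "nat \<Rightarrow> (real \<Rightarrow> real) \<Rightarrow> (real \<Rightarrow> real) \<Rightarrow> (int \<Rightarrow> int set) \<Rightarrow> (int \<Rightarrow> int \<Rightarrow> real \<Rightarrow> real) \<Rightarrow> bool" where
  "interval_wavelet_basis s \<phi> \<psi> I w \<longleftrightarrow>
     wavelet_pair s \<phi> \<psi> \<and>
     boundary_adapted \<phi> \<psi> I w \<and>
     (\<forall>j \<ge> -1. finite (I j)) \<and>
     (\<lambda>j. real (card (I j))) \<in> \<Theta>[principal {-1..}](\<lambda>j. 2 powr real_of_int j) \<and>
     orthonormal_basis unit_interval (SIGMA j:{-1..}. I j) (\<lambda>(j, k). w j k) \<and>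
     (\<exists>C :: real. \<forall>p \<ge> 1. \<forall>d f. wavelet_series I w d f \<longrightarrow>
        Lp_norm unit_interval p f \<le>
          ennreal C *
          (\<Sum>i. let j = int i - 1 in
             ennreal (2 powr (of_int j * (1 / 2 - inv_exponent p))) *
             Lp_norm (count_space (I j)) p (d j)))"

definition coef_bound :: "real \<Rightarrow> real \<Rightarrow> int \<Rightarrow> real" where
  "coef_bound \<beta> Q j = Q * 2 powr (- (of_int j / 2) * (2 * \<beta> + 1))"

definition parameter_space ::
  "(int \<Rightarrow> int set) \<Rightarrow> (int \<Rightarrow> int \<Rightarrow> real \<Rightarrow> real) \<Rightarrow> real \<Rightarrow> real \<Rightarrow> (real \<Rightarrow> real) set" where
  "parameter_space I w \<beta> Q =
     {f. \<exists>d. wavelet_series I w d f \<and> (\<forall>j \<ge> -1. \<forall>k\<in>I j. \<bar>d j k\<bar> \<le> coef_bound \<beta> Q j)}"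


section \<open>Gaussian white noise\<close>

text \<open>Brownian motion on the time interval \<open>[0,1]\<close>.\<close>

definition brownian_motion :: "'w measure \<Rightarrow> (real \<Rightarrow> 'w \<Rightarrow> real) \<Rightarrow> bool" where
  "brownian_motion M W \<longleftrightarrow>
     prob_space M \<and>
     (\<forall>t\<in>{0..1}. W t \<in> borel_measurable M) \<and>
     (AE \<omega> in M. W 0 \<omega> = 0) \<and>
     (\<forall>s t. 0 \<le> s \<longrightarrow> s < t \<longrightarrow> t \<le> 1 \<longrightarrow>
        distributed M lborel (\<lambda>\<omega>. W t \<omega> - W s \<omega>) (normal_density 0 (sqrt (t - s)))) \<and>
     (\<forall>(m :: nat) t. mono_on {..m} t \<longrightarrow> t ` {..m} \<subseteq> {0..1} \<longrightarrow>
        prob_space.indep_vars M (\<lambda>_. borel) (\<lambda>i \<omega>. W (t (Suc i)) \<omega> - W (t i) \<omega>) {..<m}) \<and>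
     (AE \<omega> in M. continuous_on {0..1} (\<lambda>t. W t \<omega>))"

text \<open>
  \<open>dY\<^sub>t = f(t) dt + n\<^sup>-\<^sup>1\<^sup>/\<^sup>2 dW\<^sub>t\<close> with \<open>Y\<^sub>0 = 0\<close>, solved for \<open>W\<close>: the observation \<open>Y\<close> is a fixed
  process, and it is the law \<open>P f\<close> that depends on the regression function \<open>f\<close>.
\<close>

definition white_noise_model ::
  "nat \<Rightarrow> ((real \<Rightarrow> real) \<Rightarrow> 'w measure) \<Rightarrow> (real \<Rightarrow> 'w \<Rightarrow> real) \<Rightarrow> bool" where
  "white_noise_model n P Y \<longleftrightarrow>
     (\<forall>f\<in>square_integrable unit_interval. \<forall>g\<in>square_integrable unit_interval.
        sets (P f) = sets (P g)) \<and>
     (\<forall>f\<in>square_integrable unit_interval.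
        brownian_motion (P f)
          (\<lambda>t \<omega>. sqrt (real n) * (Y t \<omega> - (\<integral>u. f u \<partial>lebesgue_on {0..t}))))"

definition step_fun :: "nat \<Rightarrow> (nat \<Rightarrow> real) \<Rightarrow> (nat \<Rightarrow> real) \<Rightarrow> real \<Rightarrow> real" where
  "step_fun m t a x = (\<Sum>i<m. a i * indicator {t i<..t (Suc i)} x)"

definition step_integral ::
  "nat \<Rightarrow> (nat \<Rightarrow> real) \<Rightarrow> (nat \<Rightarrow> real) \<Rightarrow> (real \<Rightarrow> 'w \<Rightarrow> real) \<Rightarrow> 'w \<Rightarrow> real" where
  "step_integral m t a Y \<omega> = (\<Sum>i<m. a i * (Y (t (Suc i)) \<omega> - Y (t i) \<omega>))"

text \<open>
  \<open>X\<close> is a version of the stochastic integral of the deterministic \<open>L\<^sup>2\<close> function \<open>h\<close> against \<open>Y\<close>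
  over \<open>[0,1]\<close>: the mean square limit of the integrals of step functions tending to \<open>h\<close> in
  \<open>L\<^sup>2[0,1]\<close>. By the Ito isometry the choice of the step functions is immaterial.
\<close>

definition stochastic_integral ::
  "'w measure \<Rightarrow> (real \<Rightarrow> 'w \<Rightarrow> real) \<Rightarrow> (real \<Rightarrow> real) \<Rightarrow> ('w \<Rightarrow> real) \<Rightarrow> bool" where
  "stochastic_integral M Y h X \<longleftrightarrow>
     X \<in> borel_measurable M \<and>
     (\<exists>(m :: nat \<Rightarrow> nat) (t :: nat \<Rightarrow> nat \<Rightarrow> real) (a :: nat \<Rightarrow> nat \<Rightarrow> real).
        (\<forall>r. mono_on {..m r} (t r) \<and> t r ` {..m r} \<subseteq> {0..1}) \<and>
        (\<lambda>r. Lp_norm unit_interval 2 (\<lambda>x. step_fun (m r) (t r) (a r) x - h x)) \<longlonglongrightarrow> 0 \<and>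
        (\<lambda>r. Lp_norm M 2 (\<lambda>\<omega>. step_integral (m r) (t r) (a r) Y \<omega> - X \<omega>)) \<longlonglongrightarrow> 0)"

text \<open>
  The integral is only determined up to null sets, so \<open>y j k\<close> is any statistic that is a version
  of it under every \<open>P f\<close>. It must not depend on the unknown \<open>f\<close>.
\<close>

definition empirical_coefs ::
  "(int \<Rightarrow> int set) \<Rightarrow> (int \<Rightarrow> int \<Rightarrow> real \<Rightarrow> real) \<Rightarrow> ((real \<Rightarrow> real) \<Rightarrow> 'w measure) \<Rightarrow>
   (real \<Rightarrow> 'w \<Rightarrow> real) \<Rightarrow> (int \<Rightarrow> int \<Rightarrow> 'w \<Rightarrow> real) \<Rightarrow> bool" where
  "empirical_coefs I w P Y y \<longleftrightarrow>
     (\<forall>f\<in>square_integrable unit_interval. \<forall>j \<ge> -1. \<forall>k\<in>I j.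
        stochastic_integral (P f) Y (w j k) (y j k))"


section \<open>The estimator and the rate\<close>

definition clipped_coef :: "real \<Rightarrow> real \<Rightarrow> int \<Rightarrow> real \<Rightarrow> real" where
  "clipped_coef \<beta> Q j v = sgn v * min \<bar>v\<bar> (coef_bound \<beta> Q j)"

definition estimator ::
  "(int \<Rightarrow> int set) \<Rightarrow> (int \<Rightarrow> int \<Rightarrow> real \<Rightarrow> real) \<Rightarrow> real \<Rightarrow> real \<Rightarrow> int \<Rightarrow>
   (int \<Rightarrow> int \<Rightarrow> 'w \<Rightarrow> real) \<Rightarrow> 'w \<Rightarrow> real \<Rightarrow> real" where
  "estimator I w \<beta> Q J y \<omega> x =
     (\<Sum>j\<in>{-1..J}. \<Sum>k\<in>I j. clipped_coef \<beta> Q j (y j k \<omega>) * w j k x)"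

definition minimax_rate :: "real \<Rightarrow> ennreal \<Rightarrow> nat \<Rightarrow> real" where
  "minimax_rate \<beta> p n =
     (if p = \<infinity> then (real n / ln (real n)) powr (- \<beta> / (2 * \<beta> + 1))
      else real n powr (- \<beta> / (2 * \<beta> + 1)))"

end

theory Submission
  imports Defs
begin

text \<open>
  The error of the estimator has a wavelet series, so the norm inequality of the basis reduces the
  risk to the single resolution levels. The empirical coefficients are \<open>L\<^sup>2\<close> limits of Gaussian
  variables, hence \<open>sqrt n (y j k - d j k)\<close> is subgaussian. As clipping is a contraction, the
  weighted error of level \<open>j \<le> J\<close> has expectation at most a constant times \<open>2\<^bsup>j/2\<^esup> N\<^bsup>-1/2\<^esup>\<close>, where
  \<open>N = n\<close> for \<open>p < \<infinity>\<close> and \<open>N = n / ln n\<close> for \<open>p = \<infinity>\<close> (a maximum over \<open>2\<^sup>j\<close> noise variables).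
  Clipping also keeps it at most a constant times \<open>2\<^bsup>-\<beta>j\<^esup>\<close> on every level. Using the first bound for
  \<open>j \<le> L\<close> and the second for \<open>j > L\<close>, where \<open>2\<^sup>L\<close> is of order \<open>N\<^bsup>1/(2\<beta>+1)\<^esup>\<close>, the sum over the
  levels is geometric on both sides of \<open>L\<close> and has the order \<open>N\<^bsup>-\<beta>/(2\<beta>+1)\<^esup>\<close> of the level \<open>L\<close>. Without
  the clipping, the levels between \<open>L\<close> and \<open>J\<close> would spoil the logarithmic factor when \<open>p = \<infinity>\<close>.
\<close>


section \<open>Square integrable functions\<close>

lemma Lp_norm_uminus: "Lp_norm M p (\<lambda>x. - f x) = Lp_norm M p f"
  by (simp add: Lp_norm_def)

lemma enn2real_two [simp]: "enn2real 2 = 2"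
  by (metis enn2real_ennreal ennreal_numeral zero_le_numeral)

text \<open>Passage from the extended norm, in which wavelet series and stochastic integrals are
  defined, to Bochner integrals. The latter default to 0 for nonintegrable functions; finiteness of
  the norm excludes that case.\<close>

lemma Lp_norm_two_finite:
  assumes [measurable]: "u \<in> borel_measurable M" and fin: "Lp_norm M 2 u < \<infinity>"
  shows "u \<in> square_integrable M" and "(\<integral>x. (u x)\<^sup>2 \<partial>M) = (enn2real (Lp_norm M 2 u))\<^sup>2"
proof -
  define I where "I = (\<integral>\<^sup>+ x. ennreal ((u x)\<^sup>2) \<partial>M)"
  have pw: "\<bar>a\<bar> powr 2 = a\<^sup>2" for a :: real
    by (cases "a = 0") (simp_all add: powr_numeral)
  have Lp: "Lp_norm M 2 u = (if I = \<infinity> then \<infinity> else ennreal (enn2real I powr (1 / 2)))"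
    by (simp add: Lp_norm_def I_def pw Let_def)
  with fin have I: "I < \<infinity>"
    by (auto simp: less_top split: if_splits)
  then have int: "integrable M (\<lambda>x. (u x)\<^sup>2)"
    by (subst integrable_iff_bounded) (simp add: I_def)
  then show "u \<in> square_integrable M"
    by (simp add: square_integrable_def)
  have "(\<integral>x. (u x)\<^sup>2 \<partial>M) = enn2real I"
    unfolding I_def by (subst integral_eq_nn_integral) auto
  also have "\<dots> = (enn2real (Lp_norm M 2 u))\<^sup>2"
    using I by (simp add: Lp powr_half_sqrt)
  finally show "(\<integral>x. (u x)\<^sup>2 \<partial>M) = (enn2real (Lp_norm M 2 u))\<^sup>2" .
qed

text \<open>A null sequence of extended norms may start with infinite values, so square
  integrability is available only eventually.\<close>

lemma Lp_norm_two_tendsto_zero: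
  assumes meas: "\<And>r. u r \<in> borel_measurable M"
    and lim: "(\<lambda>r. Lp_norm M 2 (u r)) \<longlonglongrightarrow> 0"
  shows "\<forall>\<^sub>F r in sequentially. u r \<in> square_integrable M"
    and "(\<lambda>r. \<integral>x. (u r x)\<^sup>2 \<partial>M) \<longlonglongrightarrow> 0"
proof -
  have fin: "\<forall>\<^sub>F r in sequentially. Lp_norm M 2 (u r) < \<infinity>"
    by (rule order_tendstoD(2)[OF lim]) simp
  then show "\<forall>\<^sub>F r in sequentially. u r \<in> square_integrable M"
    by eventually_elim (use meas Lp_norm_two_finite in blast)
  have "(\<lambda>r. (enn2real (Lp_norm M 2 (u r)))\<^sup>2) \<longlonglongrightarrow> 0\<^sup>2"
    by (intro tendsto_power tendsto_enn2real) (use lim in auto)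
  moreover have "\<forall>\<^sub>F r in sequentially. (enn2real (Lp_norm M 2 (u r)))\<^sup>2 = (\<integral>x. (u r x)\<^sup>2 \<partial>M)"
    using fin by eventually_elim (simp add: Lp_norm_two_finite(2) meas)
  ultimately show "(\<lambda>r. \<integral>x. (u r x)\<^sup>2 \<partial>M) \<longlonglongrightarrow> 0"
    using Lim_transform_eventually by fastforce
qed

section \<open>Vector space structure and inner product of square integrable functions\<close>

lemma square_integrable_measurable:
  "f \<in> square_integrable M \<Longrightarrow> f \<in> borel_measurable M"
  by (simp add: square_integrable_def)

lemma square_integrable_mult:
  assumes "f \<in> square_integrable M" "g \<in> square_integrable M"
  shows "integrable M (\<lambda>x. f x * g x)"
proof (rule Bochner_Integration.integrable_bound)
  show "integrable M (\<lambda>x. (f x)\<^sup>2 + (g x)\<^sup>2)"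
    using assms by (simp add: square_integrable_def)
  show "(\<lambda>x. f x * g x) \<in> borel_measurable M"
    using assms by (intro borel_measurable_times square_integrable_measurable)
  have "\<bar>a * b\<bar> \<le> a\<^sup>2 + b\<^sup>2" for a b :: real
    using sum_squares_bound[of "\<bar>a\<bar>" "\<bar>b\<bar>"] mult_nonneg_nonneg[OF abs_ge_zero abs_ge_zero, of a b]
    unfolding abs_mult power2_abs mult.assoc by linarith
  then show "AE x in M. norm (f x * g x) \<le> norm ((f x)\<^sup>2 + (g x)\<^sup>2)"
    by simp
qed

lemma square_integrable_add:
  assumes "f \<in> square_integrable M" "g \<in> square_integrable M"
  shows "(\<lambda>x. f x + g x) \<in> square_integrable M"
proof -
  have "integrable M (\<lambda>x. (f x)\<^sup>2 + (g x)\<^sup>2 + 2 * (f x * g x))"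
    using assms square_integrable_mult[OF assms] by (simp add: square_integrable_def)
  with assms show ?thesis
    by (simp add: square_integrable_def power2_sum mult.assoc borel_measurable_add)
qed

lemma square_integrable_cmult:
  assumes "f \<in> square_integrable M"
  shows "(\<lambda>x. c * f x) \<in> square_integrable M"
  using assms
  by (simp add: square_integrable_def power_mult_distrib borel_measurable_times)

lemma square_integrable_diff:
  assumes "f \<in> square_integrable M" "g \<in> square_integrable M"
  shows "(\<lambda>x. f x - g x) \<in> square_integrable M"
  using square_integrable_add[OF assms(1) square_integrable_cmult[OF assms(2), of "-1"]] by simp

lemma square_integrable_sum:
  assumes "\<And>i. i \<in> A \<Longrightarrow> f i \<in> square_integrable M"
  shows "(\<lambda>x. \<Sum>i\<in>A. f i x) \<in> square_integrable M"
  using assms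
proof (induction A rule: infinite_finite_induct)
  case (insert i A)
  then show ?case
    using square_integrable_add[of "f i" M "\<lambda>x. \<Sum>i\<in>A. f i x"] by simp
qed (simp_all add: square_integrable_def)

text \<open>Discriminant argument: the integral of the square of \<open>t * f x + g x\<close> is a
  nonnegative quadratic in \<open>t\<close>, evaluated at its minimiser \<open>- c / a\<close> when
  \<open>a \<noteq> 0\<close>.\<close>

lemma integral_Cauchy_Schwarz:
  assumes "f \<in> square_integrable M" "g \<in> square_integrable M"
  shows "(\<integral>x. f x * g x \<partial>M)\<^sup>2 \<le> (\<integral>x. (f x)\<^sup>2 \<partial>M) * (\<integral>x. (g x)\<^sup>2 \<partial>M)"
proof -
  define a b c where "a = (\<integral>x. (f x)\<^sup>2 \<partial>M)" and "b = (\<integral>x. (g x)\<^sup>2 \<partial>M)"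
    and "c = (\<integral>x. f x * g x \<partial>M)"
  have quad: "0 \<le> t\<^sup>2 * a + 2 * t * c + b" for t
  proof -
    have "0 \<le> (\<integral>x. (t * f x + g x)\<^sup>2 \<partial>M)"
      by simp
    also have "\<dots> = (\<integral>x. t\<^sup>2 * (f x)\<^sup>2 + 2 * t * (f x * g x) + (g x)\<^sup>2 \<partial>M)"
      by (simp add: power2_sum power_mult_distrib algebra_simps)
    also have "\<dots> = t\<^sup>2 * a + 2 * t * c + b"
      using assms square_integrable_mult[OF assms]
      by (simp add: a_def b_def c_def square_integrable_def)
    finally show ?thesis .
  qed
  have "a \<ge> 0"
    by (simp add: a_def)
  show ?thesis
  proof (cases "a = 0")
    case True
    have "c = 0"
    proof (rule ccontr)
      assume "c \<noteq> 0"
      \<comment> \<open>For \<open>a = 0\<close> the quadratic reduces to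
        \<open>2 * t * c + b\<close>, which equals -1 at this \<open>t\<close>.\<close>
      with True quad[of "- (b + 1) / (2 * c)"] show False
        by (simp add: field_simps)
    qed
    with True show ?thesis
      by (simp add: a_def c_def)
  next
    case False
    with \<open>a \<ge> 0\<close> quad[of "- c / a"] have "c\<^sup>2 \<le> a * b"
      by (simp add: power2_eq_square field_simps)
    then show ?thesis
      by (simp add: a_def b_def c_def)
  qed
qed

lemma L2_tendsto_inner:
  assumes u: "\<forall>\<^sub>F r in F. u r \<in> square_integrable M"
    and lim: "((\<lambda>r. \<integral>x. (u r x)\<^sup>2 \<partial>M) \<longlongrightarrow> 0) F"
    and g: "g \<in> square_integrable M"
  shows "((\<lambda>r. \<integral>x. u r x * g x \<partial>M) \<longlongrightarrow> 0) F"
proof -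
  have "((\<lambda>r. sqrt ((\<integral>x. (u r x)\<^sup>2 \<partial>M) * (\<integral>x. (g x)\<^sup>2 \<partial>M))) \<longlongrightarrow> sqrt (0 * (\<integral>x. (g x)\<^sup>2 \<partial>M))) F"
    by (intro tendsto_intros lim)
  then have "((\<lambda>r. sqrt ((\<integral>x. (u r x)\<^sup>2 \<partial>M) * (\<integral>x. (g x)\<^sup>2 \<partial>M))) \<longlongrightarrow> 0) F"
    by simp
  then show ?thesis
    by (rule Lim_null_comparison[rotated])
      (use u in eventually_elim, simp add: real_le_rsqrt integral_Cauchy_Schwarz g)
qed

section \<open>Coefficients of a wavelet series\<close>

text \<open>Taking the inner product with \<open>w j k\<close> is continuous in mean square, and by
  orthonormality the partial sums yield \<open>d j k\<close> as soon as they include level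
  \<open>j\<close>. The parameter space only provides some \<open>d\<close>; this identifies it with
  the means of the empirical coefficients.\<close>

lemma wavelet_series_coefficient:
  assumes series: "wavelet_series I w d f"
    and onb: "orthonormal_basis unit_interval (SIGMA j:{-1..}. I j) (\<lambda>(j, k). w j k)"
    and fin: "\<forall>j \<ge> -1. finite (I j)" and j: "j \<ge> -1" and k: "k \<in> I j"
  shows "d j k = (\<integral>x. f x * w j k x \<partial>unit_interval)"
proof -
  have w: "w j k \<in> square_integrable unit_interval" if "j \<ge> -1" "k \<in> I j" for j k
    using onb that by (auto simp: orthonormal_basis_def)
  have inner: "(\<integral>x. w i l x * w j k x \<partial>unit_interval) = (if i = j \<and> l = k then 1 else 0)"
    if "i \<ge> -1" "l \<in> I i" for i l
  proof -
    have "\<forall>a\<in>(SIGMA j:{-1..}. I j). \<forall>b\<in>(SIGMA j:{-1..}. I j).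
        (\<integral>x. (case a of (j, k) \<Rightarrow> w j k) x * (case b of (j, k) \<Rightarrow> w j k) x \<partial>unit_interval) =
          (if a = b then 1 else 0)"
      using onb by (simp add: orthonormal_basis_def)
    from this[rule_format, of "(i, l)" "(j, k)"] that j k show ?thesis
      by simp
  qed
  define S where "S N x = (\<Sum>i\<in>{-1..int N}. \<Sum>l\<in>I i. d i l * w i l x)" for N x
  have S: "S N \<in> square_integrable unit_interval" for N
    unfolding S_def by (intro square_integrable_sum square_integrable_cmult w) auto
  have f: "f \<in> square_integrable unit_interval"
    using series by (simp add: wavelet_series_def)
  have diff: "(\<lambda>x. f x - S N x) \<in> square_integrable unit_interval" for N
    using f S by (rule square_integrable_diff)
  have "(\<lambda>N. Lp_norm unit_interval 2 (\<lambda>x. f x - S N x)) \<longlonglongrightarrow> 0"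
    using series by (simp add: wavelet_series_def S_def)
  from Lp_norm_two_tendsto_zero(2)[OF square_integrable_measurable[OF diff] this]
  have "(\<lambda>N. \<integral>x. (f x - S N x) * w j k x \<partial>unit_interval) \<longlonglongrightarrow> 0"
    by (intro L2_tendsto_inner) (use diff w j k in auto)
  moreover have "\<forall>\<^sub>F N in sequentially. (\<integral>x. (f x - S N x) * w j k x \<partial>unit_interval) =
      (\<integral>x. f x * w j k x \<partial>unit_interval) - d j k"
  \<comment> \<open>Level -1 belongs to every partial sum, which agrees with
    \<open>nat (-1) = 0\<close>.\<close>
  proof (rule eventually_sequentiallyI[of "nat j"])
    fix N assume "nat j \<le> N"
    with j have jN: "j \<in> {-1..int N}"
      by auto
    have "(\<integral>x. S N x * w j k x \<partial>unit_interval) =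
        (\<integral>x. (\<Sum>i\<in>{-1..int N}. \<Sum>l\<in>I i. d i l * (w i l x * w j k x)) \<partial>unit_interval)"
      by (simp add: S_def sum_distrib_right mult.assoc)
    also have "\<dots> = (\<Sum>i\<in>{-1..int N}. \<Sum>l\<in>I i. d i l * (\<integral>x. w i l x * w j k x \<partial>unit_interval))"
    proof -
      have int: "integrable unit_interval (\<lambda>x. d i l * (w i l x * w j k x))" if "i \<in> {-1..int N}" "l \<in> I i" for i l
        using that by (intro integrable_mult_right square_integrable_mult w j k) auto
      have "(\<integral>x. (\<Sum>i\<in>{-1..int N}. \<Sum>l\<in>I i. d i l * (w i l x * w j k x)) \<partial>unit_interval) =
          (\<Sum>i\<in>{-1..int N}. \<integral>x. (\<Sum>l\<in>I i. d i l * (w i l x * w j k x)) \<partial>unit_interval)"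
        by (intro Bochner_Integration.integral_sum Bochner_Integration.integrable_sum int)
      also have "\<dots> = (\<Sum>i\<in>{-1..int N}. \<Sum>l\<in>I i. \<integral>x. d i l * (w i l x * w j k x) \<partial>unit_interval)"
        by (intro sum.cong refl Bochner_Integration.integral_sum int)
      finally show ?thesis
        by simp
    qed
    also have "\<dots> = (\<Sum>i\<in>{-1..int N}. \<Sum>l\<in>I i. if i = j \<and> l = k then d i l else 0)"
      by (intro sum.cong refl) (auto simp: inner)
    also have "\<dots> = (\<Sum>i\<in>{-1..int N}. if i = j then d j k else 0)"
      by (intro sum.cong refl) (use fin k j in \<open>auto simp: if_distrib sum.delta\<close>)
    also have "\<dots> = d j k"
      using jN by simp
    finally have "(\<integral>x. S N x * w j k x \<partial>unit_interval) = d j k" .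
    then show "(\<integral>x. (f x - S N x) * w j k x \<partial>unit_interval) =
        (\<integral>x. f x * w j k x \<partial>unit_interval) - d j k"
      using square_integrable_mult[OF f w[OF j k]] square_integrable_mult[OF S w[OF j k]]
      by (simp add: left_diff_distrib)
  qed
  ultimately have "(\<lambda>N::nat. (\<integral>x. f x * w j k x \<partial>unit_interval) - d j k) \<longlonglongrightarrow> 0"
    by (rule Lim_transform_eventually)
  then show ?thesis
    by (simp add: tendsto_const_iff)
qed


section \<open>Exponential moments of Wiener integrals\<close>

text \<open>Completing the square leaves the normal density with mean shifted to
  \<open>c * \<sigma>\<^sup>2\<close>, whose total mass is 1.\<close>

lemma nn_integral_exp_normal_density:
  assumes "0 < \<sigma>"
  shows "(\<integral>\<^sup>+ x. ennreal (normal_density 0 \<sigma> x) * ennreal (exp (c * x)) \<partial>lborel) =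
    ennreal (exp (c\<^sup>2 * \<sigma>\<^sup>2 / 2))"
proof -
  have eq: "normal_density 0 \<sigma> x * exp (c * x) =
      exp (c\<^sup>2 * \<sigma>\<^sup>2 / 2) * normal_density (c * \<sigma>\<^sup>2) \<sigma> x" for x
  proof -
    have "- x\<^sup>2 / (2 * \<sigma>\<^sup>2) + c * x = c\<^sup>2 * \<sigma>\<^sup>2 / 2 - (x - c * \<sigma>\<^sup>2)\<^sup>2 / (2 * \<sigma>\<^sup>2)"
      using assms by (simp add: power2_eq_square field_simps)
    then have "exp (- x\<^sup>2 / (2 * \<sigma>\<^sup>2)) * exp (c * x) =
        exp (c\<^sup>2 * \<sigma>\<^sup>2 / 2) * exp (- ((x - c * \<sigma>\<^sup>2)\<^sup>2) / (2 * \<sigma>\<^sup>2))"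
      by (simp flip: exp_add)
    then show ?thesis
      by (simp add: normal_density_def algebra_simps)
  qed
  have "(\<integral>\<^sup>+ x. ennreal (normal_density 0 \<sigma> x) * ennreal (exp (c * x)) \<partial>lborel) =
      (\<integral>\<^sup>+ x. ennreal (exp (c\<^sup>2 * \<sigma>\<^sup>2 / 2)) * ennreal (normal_density (c * \<sigma>\<^sup>2) \<sigma> x) \<partial>lborel)"
    by (simp add: eq flip: ennreal_mult)
  also have "\<dots> = ennreal (exp (c\<^sup>2 * \<sigma>\<^sup>2 / 2)) * ennreal (\<integral>x. normal_density (c * \<sigma>\<^sup>2) \<sigma> x \<partial>lborel)"
    using assms by (simp add: nn_integral_cmult nn_integral_eq_integral)
  finally show ?thesis
    using assms by simp
qed

text \<open>The normal law in \<open>brownian_motion\<close> concerns \<open>s < t\<close> only, but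
  the points of a monotone partition may coincide; for \<open>s = t\<close> both sides are
  1.\<close>

lemma brownian_motion_increment_mgf:
  assumes bm: "brownian_motion M W" and "0 \<le> s" "s \<le> t" "t \<le> 1"
  shows "(\<integral>\<^sup>+ \<omega>. ennreal (exp (c * (W t \<omega> - W s \<omega>))) \<partial>M) = ennreal (exp (c\<^sup>2 * (t - s) / 2))"
proof (cases "s = t")
  case True
  interpret prob_space M
    using bm by (simp add: brownian_motion_def)
  show ?thesis
    using True by (simp add: emeasure_space_1)
next
  case False
  with assms have st: "s < t"
    by simp
  with bm assms have D: "distributed M lborel (\<lambda>\<omega>. W t \<omega> - W s \<omega>) (normal_density 0 (sqrt (t - s)))"
    by (simp add: brownian_motion_def)
  have "(\<integral>\<^sup>+ \<omega>. ennreal (exp (c * (W t \<omega> - W s \<omega>))) \<partial>M) =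
      (\<integral>\<^sup>+ x. ennreal (normal_density 0 (sqrt (t - s)) x) * ennreal (exp (c * x)) \<partial>lborel)"
    by (rule distributed_nn_integral[OF D, symmetric]) simp
  also have "\<dots> = ennreal (exp (c\<^sup>2 * (t - s) / 2))"
    using st by (subst nn_integral_exp_normal_density) auto
  finally show ?thesis .
qed

text \<open>Independence of the increments turns the expectation of the product of exponentials into
  the product of the expectations.\<close>

lemma step_integral_mgf:
  assumes bm: "brownian_motion M W" and mono: "mono_on {..m} t" and t: "t ` {..m} \<subseteq> {0..1}"
  shows "(\<integral>\<^sup>+ \<omega>. ennreal (exp (c * step_integral m t a W \<omega>)) \<partial>M) =
    ennreal (exp (c\<^sup>2 / 2 * (\<Sum>i<m. (a i)\<^sup>2 * (t (Suc i) - t i))))"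
proof -
  interpret prob_space M
    using bm by (simp add: brownian_motion_def)
  have "indep_vars (\<lambda>_. borel) (\<lambda>i \<omega>. W (t (Suc i)) \<omega> - W (t i) \<omega>) {..<m}"
    using bm mono t by (simp add: brownian_motion_def)
  then have indep: "indep_vars (\<lambda>_. borel)
      (\<lambda>i \<omega>. ennreal (exp (c * a i * (W (t (Suc i)) \<omega> - W (t i) \<omega>)))) {..<m}"
    by (rule indep_vars_compose2) simp
  have "(\<integral>\<^sup>+ \<omega>. ennreal (exp (c * step_integral m t a W \<omega>)) \<partial>M) =
      (\<integral>\<^sup>+ \<omega>. (\<Prod>i<m. ennreal (exp (c * a i * (W (t (Suc i)) \<omega> - W (t i) \<omega>)))) \<partial>M)"
    by (simp add: step_integral_def sum_distrib_left exp_sum prod_ennreal mult.assoc)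
  also have "\<dots> = (\<Prod>i<m. \<integral>\<^sup>+ \<omega>. ennreal (exp (c * a i * (W (t (Suc i)) \<omega> - W (t i) \<omega>))) \<partial>M)"
    by (rule indep_vars_nn_integral) (use indep in auto)
  also have "\<dots> = (\<Prod>i<m. ennreal (exp ((c * a i)\<^sup>2 * (t (Suc i) - t i) / 2)))"
  proof (intro prod.cong refl)
    fix i assume "i \<in> {..<m}"
    with t mono have "0 \<le> t i" "t i \<le> t (Suc i)" "t (Suc i) \<le> 1"
      by (auto simp: image_subset_iff intro: mono_onD)
    then show "(\<integral>\<^sup>+ \<omega>. ennreal (exp (c * a i * (W (t (Suc i)) \<omega> - W (t i) \<omega>))) \<partial>M) =
        ennreal (exp ((c * a i)\<^sup>2 * (t (Suc i) - t i) / 2))"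
      by (rule brownian_motion_increment_mgf[OF bm])
  qed
  also have "\<dots> = ennreal (exp (c\<^sup>2 / 2 * (\<Sum>i<m. (a i)\<^sup>2 * (t (Suc i) - t i))))"
    by (simp add: prod_ennreal sum_distrib_left power_mult_distrib mult.assoc flip: exp_sum)
  finally show ?thesis .
qed

section \<open>Step functions and their inner products\<close>

text \<open>The half-open cells of a monotone partition are disjoint, so all cross terms of the
  square vanish.\<close>

lemma step_fun_power2:
  assumes "mono_on {..m} t"
  shows "(step_fun m t a x)\<^sup>2 = step_fun m t (\<lambda>i. (a i)\<^sup>2) x"
  using assms
proof (induction m)
  case 0
  then show ?case
    by (simp add: step_fun_def)
next
  case (Suc m)
  have IH: "(step_fun m t a x)\<^sup>2 = step_fun m t (\<lambda>i. (a i)\<^sup>2) x"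
    by (rule Suc.IH) (use Suc.prems in \<open>auto simp: mono_on_def\<close>)
  have "step_fun m t a x = 0" if "x \<in> {t m<..t (Suc m)}"
  proof -
    have "x \<notin> {t i<..t (Suc i)}" if "i < m" for i
      using mono_onD[OF Suc.prems, of "Suc i" m] that \<open>x \<in> {t m<..t (Suc m)}\<close> by auto
    then show ?thesis
      by (auto simp: step_fun_def intro!: sum.neutral)
  qed
  then have "(step_fun m t a x + a m * indicator {t m<..t (Suc m)} x)\<^sup>2 =
      (step_fun m t a x)\<^sup>2 + (a m)\<^sup>2 * indicator {t m<..t (Suc m)} x"
    by (cases "x \<in> {t m<..t (Suc m)}") auto
  moreover have "step_fun (Suc m) t b x = step_fun m t b x + b m * indicator {t m<..t (Suc m)} x" for b
    by (simp add: step_fun_def)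
  ultimately show ?case
    by (simp add: IH)
qed

lemma step_fun_measurable [measurable]: "step_fun m t a \<in> borel_measurable unit_interval"
proof -
  have "step_fun m t a \<in> borel_measurable borel"
    unfolding step_fun_def by measurable
  then have "step_fun m t a \<in> borel_measurable lebesgue"
    by (rule measurable_completion[of _ lborel, unfolded measurable_lborel2])
  then show ?thesis
    by (rule measurable_restrict_space1)
qed

text \<open>The indicator of \<open>{s<..t}\<close> is the difference of those of
  \<open>{0..t}\<close> and \<open>{0..s}\<close>. The right-hand side is the drift of
  \<open>Y\<close> over \<open>{s<..t}\<close> in the white noise model.\<close>

lemma integral_indicator_unit_interval:
  fixes f :: "real \<Rightarrow> real"
  assumes f: "integrable unit_interval f" and "0 \<le> s" "s \<le> t" "t \<le> 1"
  shows "integrable unit_interval (\<lambda>x. indicator {s<..t} x * f x)"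
    and "(\<integral>x. indicator {s<..t} x * f x \<partial>unit_interval) =
      (\<integral>x. f x \<partial>lebesgue_on {0..t}) - (\<integral>x. f x \<partial>lebesgue_on {0..s})"
proof -
  have f': "integrable lebesgue (\<lambda>x. indicator {0..1} x * f x)"
    using f by (simp add: integrable_restrict_space)
  have cut: "integrable lebesgue (\<lambda>x. indicator {0..u} x * f x)" if "u \<le> 1" for u
  proof -
    have "integrable lebesgue (\<lambda>x. indicator {0..u} x *\<^sub>R (indicator {0..1} x * f x))"
      by (rule integrable_mult_indicator[OF _ f']) simp
    moreover have "(\<lambda>x. indicator {0..u} x *\<^sub>R (indicator {0..1} x * f x)) =
        (\<lambda>x. indicator {0..u} x * f x)"
      using that by (auto simp: indicator_def fun_eq_iff)
    ultimately show ?thesis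
      by simp
  qed
  have eq: "indicator {0..1} x * (indicator {s<..t} x * f x) =
      indicator {0..t} x * f x - indicator {0..s} x * f x" for x
    using assms by (auto simp: indicator_def)
  show "integrable unit_interval (\<lambda>x. indicator {s<..t} x * f x)"
    using cut assms by (simp add: integrable_restrict_space eq)
  show "(\<integral>x. indicator {s<..t} x * f x \<partial>unit_interval) =
      (\<integral>x. f x \<partial>lebesgue_on {0..t}) - (\<integral>x. f x \<partial>lebesgue_on {0..s})"
    using cut assms by (simp add: integral_restrict_space eq)
qed

text \<open>Summing over the cells shows that the inner product with \<open>f\<close> is the drift
  part of the step integral against \<open>Y\<close>.\<close>

lemma integral_step_fun_mult:
  assumes f: "integrable unit_interval f" and mono: "mono_on {..m} t" and t: "t ` {..m} \<subseteq> {0..1}"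
  shows "integrable unit_interval (\<lambda>x. step_fun m t a x * f x)"
    and "(\<integral>x. step_fun m t a x * f x \<partial>unit_interval) =
      (\<Sum>i<m. a i * ((\<integral>u. f u \<partial>lebesgue_on {0..t (Suc i)}) - (\<integral>u. f u \<partial>lebesgue_on {0..t i})))"
proof -
  have ti: "0 \<le> t i" "t i \<le> t (Suc i)" "t (Suc i) \<le> 1" if "i < m" for i
    using t mono that by (auto simp: image_subset_iff intro: mono_onD)
  have eq: "step_fun m t a x * f x = (\<Sum>i<m. a i * (indicator {t i<..t (Suc i)} x * f x))" for x
    by (simp only: step_fun_def sum_distrib_right mult.assoc)
  have int: "integrable unit_interval (\<lambda>x. a i * (indicator {t i<..t (Suc i)} x * f x))"
    if "i < m" for i
    using that by (intro integrable_mult_right integral_indicator_unit_interval(1) f ti)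
  show "integrable unit_interval (\<lambda>x. step_fun m t a x * f x)"
    unfolding eq by (intro Bochner_Integration.integrable_sum int) simp
  show "(\<integral>x. step_fun m t a x * f x \<partial>unit_interval) =
      (\<Sum>i<m. a i * ((\<integral>u. f u \<partial>lebesgue_on {0..t (Suc i)}) - (\<integral>u. f u \<partial>lebesgue_on {0..t i})))"
    unfolding eq
    by (subst Bochner_Integration.integral_sum)
      (auto simp: integral_indicator_unit_interval[OF f ti])
qed

lemma const_square_integrable_unit_interval: "(\<lambda>x. c) \<in> square_integrable unit_interval"
proof -
  have "finite_measure unit_interval"
    by (rule finite_measure_lebesgue_on) simp
  then show ?thesis
    by (simp add: square_integrable_def finite_measure.integrable_const)
qed

lemma square_integrable_imp_integrable_unit_interval:
  assumes "f \<in> square_integrable unit_interval"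
  shows "integrable unit_interval f"
  using square_integrable_mult[OF assms const_square_integrable_unit_interval[of 1]] by simp

text \<open>The constant 1 and the squared coefficients in \<open>integral_step_fun_mult\<close>
  produce the lengths of the cells. The resulting sum is the one in the exponent of
  \<open>step_integral_mgf\<close>.\<close>

lemma step_fun_square_integrable:
  assumes "mono_on {..m} t" "t ` {..m} \<subseteq> {0..1}"
  shows "step_fun m t a \<in> square_integrable unit_interval"
    and "(\<integral>x. (step_fun m t a x)\<^sup>2 \<partial>unit_interval) = (\<Sum>i<m. (a i)\<^sup>2 * (t (Suc i) - t i))"
proof -
  have one: "integrable unit_interval (\<lambda>x. 1 :: real)"
    by (rule square_integrable_imp_integrable_unit_interval const_square_integrable_unit_interval)+
  have len: "(\<integral>u. 1 \<partial>lebesgue_on {0..x}) = x" if "0 \<le> x" for x :: real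
    using that by (simp add: measure_restrict_space)
  show "step_fun m t a \<in> square_integrable unit_interval"
    using integral_step_fun_mult(1)[OF one assms, of "\<lambda>i. (a i)\<^sup>2"]
    by (simp add: square_integrable_def step_fun_power2[OF assms(1)])
  have "(\<integral>x. (step_fun m t a x)\<^sup>2 \<partial>unit_interval) =
      (\<integral>x. step_fun m t (\<lambda>i. (a i)\<^sup>2) x * 1 \<partial>unit_interval)"
    by (simp add: step_fun_power2[OF assms(1)])
  also have "\<dots> = (\<Sum>i<m. (a i)\<^sup>2 *
      ((\<integral>u. 1 \<partial>lebesgue_on {0..t (Suc i)}) - (\<integral>u. 1 \<partial>lebesgue_on {0..t i})))"
    by (rule integral_step_fun_mult(2)[OF one assms])
  also have "\<dots> = (\<Sum>i<m. (a i)\<^sup>2 * (t (Suc i) - t i))"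
  proof (intro sum.cong refl)
    fix i assume "i \<in> {..<m}"
    then have "0 \<le> t i" "0 \<le> t (Suc i)"
      using assms(2) by (auto simp: image_subset_iff)
    then show "(a i)\<^sup>2 * ((\<integral>u. 1 \<partial>lebesgue_on {0..t (Suc i)}) - (\<integral>u. 1 \<partial>lebesgue_on {0..t i})) =
        (a i)\<^sup>2 * (t (Suc i) - t i)"
      by (simp only: len)
  qed
  finally show "(\<integral>x. (step_fun m t a x)\<^sup>2 \<partial>unit_interval) = (\<Sum>i<m. (a i)\<^sup>2 * (t (Suc i) - t i))" .
qed

text \<open>
  The integral is an \<open>L\<^sup>2\<close> limit of Gaussian variables whose means and variances converge, so
  Fatou's lemma along an almost surely convergent subsequence bounds its exponential moments.
\<close>

lemma stochastic_integral_subgaussian: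
  assumes bm: "brownian_motion M
      (\<lambda>t \<omega>. sqrt (real n) * (Y t \<omega> - (\<integral>u. f u \<partial>lebesgue_on {0..t})))"
    and n: "n \<ge> 1"
    and f: "f \<in> square_integrable unit_interval" and h: "h \<in> square_integrable unit_interval"
    and X: "stochastic_integral M Y h X"
  shows "(\<integral>\<^sup>+ \<omega>. ennreal (exp (c * (sqrt (real n) * (X \<omega> - (\<integral>x. f x * h x \<partial>unit_interval))))) \<partial>M)
    \<le> ennreal (exp (c\<^sup>2 / 2 * (\<integral>x. (h x)\<^sup>2 \<partial>unit_interval)))"
proof -
  interpret prob_space M
    using bm by (simp add: brownian_motion_def)
  define F where "F t = (\<integral>u. f u \<partial>lebesgue_on {0..t})" for t
  define W where "W t \<omega> = sqrt (real n) * (Y t \<omega> - F t)" for t \<omega>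
  have bm: "brownian_motion M W"
    using bm by (simp add: W_def[abs_def] F_def)
  have X_meas [measurable]: "X \<in> borel_measurable M"
    using X by (simp add: stochastic_integral_def)
  have Y_meas: "Y t \<in> borel_measurable M" if "t \<in> {0..1}" for t
  proof -
    have "W t \<in> borel_measurable M"
      using bm that by (simp add: brownian_motion_def)
    then have "(\<lambda>\<omega>. W t \<omega> / sqrt (real n) + F t) \<in> borel_measurable M"
      by simp
    moreover have "Y t = (\<lambda>\<omega>. W t \<omega> / sqrt (real n) + F t)"
      using n by (auto simp: W_def)
    ultimately show ?thesis
      by simp
  qed
  obtain m :: "nat \<Rightarrow> nat" and t a where t: "\<And>r. mono_on {..m r} (t r)" "\<And>r. t r ` {..m r} \<subseteq> {0..1}"
    and lim_h: "(\<lambda>r. Lp_norm unit_interval 2 (\<lambda>x. step_fun (m r) (t r) (a r) x - h x)) \<longlonglongrightarrow> 0"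
    and lim_X: "(\<lambda>r. Lp_norm M 2 (\<lambda>\<omega>. step_integral (m r) (t r) (a r) Y \<omega> - X \<omega>)) \<longlonglongrightarrow> 0"
    using X unfolding stochastic_integral_def by blast
  define S where "S r = step_integral (m r) (t r) (a r) Y" for r
  define g where "g r = step_fun (m r) (t r) (a r)" for r
  define A where "A r = (\<integral>x. g r x * f x \<partial>unit_interval)" for r
  define B where "B r = (\<integral>x. (g r x)\<^sup>2 \<partial>unit_interval)" for r
  have S_meas [measurable]: "S r \<in> borel_measurable M" for r
  proof -
    have "Y (t r i) \<in> borel_measurable M" if "i \<le> m r" for i
      by (rule Y_meas) (use t(2)[of r] that in auto)
    then show ?thesis
      unfolding S_def step_integral_def
      by (intro borel_measurable_sum borel_measurable_times borel_measurable_diff) auto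
  qed
  have g: "g r \<in> square_integrable unit_interval" for r
    unfolding g_def by (rule step_fun_square_integrable[OF t])
  have u: "(\<lambda>x. g r x - h x) \<in> square_integrable unit_interval" for r
    by (rule square_integrable_diff[OF g h])
  have u_lim: "(\<lambda>r. \<integral>x. (g r x - h x)\<^sup>2 \<partial>unit_interval) \<longlonglongrightarrow> 0"
    using Lp_norm_two_tendsto_zero(2)[OF square_integrable_measurable[OF u]] lim_h
    by (simp add: g_def)
  have inner_lim: "(\<lambda>r. \<integral>x. (g r x - h x) * q x \<partial>unit_interval) \<longlonglongrightarrow> 0"
    if "q \<in> square_integrable unit_interval" for q
    by (rule L2_tendsto_inner) (use u u_lim that in auto)
  \<comment> \<open>Writing \<open>g r\<close> as \<open>h\<close> plus the error
    \<open>g r - h\<close>, the error disappears in the limit both from the mean \<open>A\<close>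
    and from the variance \<open>B\<close>: its inner products with the fixed functions
    \<open>f\<close> and \<open>h\<close> and its own square integral tend to 0.\<close>
  have A_lim: "A \<longlonglongrightarrow> (\<integral>x. f x * h x \<partial>unit_interval)"
  proof -
    have "A r = (\<integral>x. (g r x - h x) * f x \<partial>unit_interval) + (\<integral>x. f x * h x \<partial>unit_interval)" for r
    proof -
      have "A r = (\<integral>x. (g r x - h x) * f x + f x * h x \<partial>unit_interval)"
        by (simp add: A_def algebra_simps)
      also have "\<dots> = (\<integral>x. (g r x - h x) * f x \<partial>unit_interval) + (\<integral>x. f x * h x \<partial>unit_interval)"
        by (intro Bochner_Integration.integral_add square_integrable_mult u f h)
      finally show ?thesis .
    qed
    then have "A = (\<lambda>r. (\<integral>x. (g r x - h x) * f x \<partial>unit_interval) + (\<integral>x. f x * h x \<partial>unit_interval))"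
      by auto
    with tendsto_add[OF inner_lim[OF f] tendsto_const[of "\<integral>x. f x * h x \<partial>unit_interval"]]
    show ?thesis
      by simp
  qed
  have B_lim: "B \<longlonglongrightarrow> (\<integral>x. (h x)\<^sup>2 \<partial>unit_interval)"
  proof -
    have "B r = (\<integral>x. (g r x - h x)\<^sup>2 \<partial>unit_interval) +
        2 * (\<integral>x. (g r x - h x) * h x \<partial>unit_interval) + (\<integral>x. (h x)\<^sup>2 \<partial>unit_interval)" for r
    proof -
      have "B r = (\<integral>x. (g r x - h x)\<^sup>2 + 2 * ((g r x - h x) * h x) + (h x)\<^sup>2 \<partial>unit_interval)"
        by (simp add: B_def power2_eq_square algebra_simps)
      also have "\<dots> = (\<integral>x. (g r x - h x)\<^sup>2 \<partial>unit_interval) +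
          2 * (\<integral>x. (g r x - h x) * h x \<partial>unit_interval) + (\<integral>x. (h x)\<^sup>2 \<partial>unit_interval)"
        using square_integrable_mult[OF u h, of r] u[of r] h
        by (simp add: square_integrable_def)
      finally show ?thesis .
    qed
    then have "B = (\<lambda>r. (\<integral>x. (g r x - h x)\<^sup>2 \<partial>unit_interval) +
        2 * (\<integral>x. (g r x - h x) * h x \<partial>unit_interval) + (\<integral>x. (h x)\<^sup>2 \<partial>unit_interval))"
      by auto
    with tendsto_add[OF tendsto_add[OF u_lim tendsto_mult[OF tendsto_const[of 2] inner_lim[OF h]]]
        tendsto_const[of "\<integral>x. (h x)\<^sup>2 \<partial>unit_interval"]]
    show ?thesis
      by simp
  qed
  \<comment> \<open>The drift of \<open>S r\<close> is exactly \<open>A r\<close>, so centring and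
    rescaling give a step integral against the Brownian motion \<open>W\<close>, with variance
    \<open>B r\<close>.\<close>
  have mgf: "(\<integral>\<^sup>+ \<omega>. ennreal (exp (c * (sqrt (real n) * (S r \<omega> - A r)))) \<partial>M) =
      ennreal (exp (c\<^sup>2 / 2 * B r))" for r
  proof -
    have "A r = (\<Sum>i<m r. a r i * (F (t r (Suc i)) - F (t r i)))"
      unfolding A_def g_def F_def
      by (rule integral_step_fun_mult(2)[OF square_integrable_imp_integrable_unit_interval[OF f] t])
    then have "sqrt (real n) * (S r \<omega> - A r) = step_integral (m r) (t r) (a r) W \<omega>" for \<omega>
      by (simp add: S_def W_def step_integral_def sum_distrib_left flip: sum_subtractf)
        (simp add: algebra_simps)
    then show ?thesis
      using step_integral_mgf[OF bm t, of c r "a r"] step_fun_square_integrable(2)[OF t, of r "a r"]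
      by (simp add: B_def g_def)
  qed
  have v: "(\<lambda>\<omega>. S r \<omega> - X \<omega>) \<in> borel_measurable M" for r
    by simp
  have "(\<lambda>r. Lp_norm M 2 (\<lambda>\<omega>. S r \<omega> - X \<omega>)) \<longlonglongrightarrow> 0"
    using lim_X by (simp add: S_def)
  note v_lim = Lp_norm_two_tendsto_zero[OF v this]
  \<comment> \<open>The differences are square integrable from some index on, whereas the extraction
    of an almost surely convergent subsequence asks for it at every index; hence the shift by
    \<open>N\<close>.\<close>
  obtain N where N: "\<And>r. r \<ge> N \<Longrightarrow> (\<lambda>\<omega>. S r \<omega> - X \<omega>) \<in> square_integrable M"
    using v_lim(1) by (auto simp: eventually_sequentially)
  obtain q :: "nat \<Rightarrow> nat" where q: "strict_mono q"
    and ae: "AE \<omega> in M. (\<lambda>r. (S (q r + N) \<omega> - X \<omega>)\<^sup>2) \<longlonglongrightarrow> 0"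
  proof -
    have "\<exists>q::nat \<Rightarrow> nat. strict_mono q \<and> (AE \<omega> in M. (\<lambda>r. (S (q r + N) \<omega> - X \<omega>)\<^sup>2) \<longlonglongrightarrow> 0)"
    proof (rule tendsto_L1_AE_subseq)
      show "integrable M (\<lambda>\<omega>. (S (r + N) \<omega> - X \<omega>)\<^sup>2)" for r
        using N[of "r + N"] by (simp add: square_integrable_def)
      show "(\<lambda>r. \<integral>\<omega>. norm ((S (r + N) \<omega> - X \<omega>)\<^sup>2) \<partial>M) \<longlonglongrightarrow> 0"
        using LIMSEQ_ignore_initial_segment[OF v_lim(2), of N] by simp
    qed
    with that show ?thesis
      by blast
  qed
  have sub: "filterlim (\<lambda>r. q r + N) at_top sequentially"
    using filterlim_subseq[OF q] by (rule filterlim_at_top_mono) auto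
  define e where "e r \<omega> = ennreal (exp (c * (sqrt (real n) * (S (q r + N) \<omega> - A (q r + N)))))" for r \<omega>
  have "AE \<omega> in M. liminf (\<lambda>r. e r \<omega>) =
      ennreal (exp (c * (sqrt (real n) * (X \<omega> - (\<integral>x. f x * h x \<partial>unit_interval)))))"
    using ae
  proof eventually_elim
    case (elim \<omega>)
    then have "(\<lambda>r. S (q r + N) \<omega> - X \<omega>) \<longlonglongrightarrow> 0"
      using tendsto_real_sqrt[OF elim] by (simp add: tendsto_rabs_zero_iff)
    then have "(\<lambda>r. S (q r + N) \<omega>) \<longlonglongrightarrow> X \<omega>"
      by (rule LIM_zero_cancel)
    moreover have "(\<lambda>r. A (q r + N)) \<longlonglongrightarrow> (\<integral>x. f x * h x \<partial>unit_interval)"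
      by (rule filterlim_compose[OF A_lim sub])
    ultimately have "(\<lambda>r. e r \<omega>) \<longlonglongrightarrow>
        ennreal (exp (c * (sqrt (real n) * (X \<omega> - (\<integral>x. f x * h x \<partial>unit_interval)))))"
      unfolding e_def by (intro tendsto_intros)
    then show ?case
      by (rule lim_imp_Liminf[rotated]) simp
  qed
  then have "(\<integral>\<^sup>+ \<omega>. ennreal (exp (c * (sqrt (real n) * (X \<omega> - (\<integral>x. f x * h x \<partial>unit_interval))))) \<partial>M) =
      (\<integral>\<^sup>+ \<omega>. liminf (\<lambda>r. e r \<omega>) \<partial>M)"
    by (intro nn_integral_cong_AE) (auto elim: eventually_mono)
  also have "\<dots> \<le> liminf (\<lambda>r. \<integral>\<^sup>+ \<omega>. e r \<omega> \<partial>M)"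
    by (rule nn_integral_liminf) (simp add: e_def)
  also have "\<dots> = liminf (\<lambda>r. ennreal (exp (c\<^sup>2 / 2 * B (q r + N))))"
    by (simp add: e_def mgf)
  also have "\<dots> = ennreal (exp (c\<^sup>2 / 2 * (\<integral>x. (h x)\<^sup>2 \<partial>unit_interval)))"
    by (intro lim_imp_Liminf tendsto_intros filterlim_compose[OF B_lim sub]) simp
  finally show ?thesis .
qed

text \<open>For either sign of \<open>c\<close>, the number
  \<open>c * \<bar>Z \<omega>\<bar>\<close> is one of \<open>c * Z \<omega>\<close> and
  \<open>- c * Z \<omega>\<close>, so its exponential is at most the sum of both exponentials. This
  costs the factor 2.\<close>

lemma stochastic_integral_exp_abs_moment:
  assumes bm: "brownian_motion M
      (\<lambda>t \<omega>. sqrt (real n) * (Y t \<omega> - (\<integral>u. f u \<partial>lebesgue_on {0..t})))"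
    and n: "n \<ge> 1"
    and f: "f \<in> square_integrable unit_interval" and h: "h \<in> square_integrable unit_interval"
    and norm: "(\<integral>x. (h x)\<^sup>2 \<partial>unit_interval) = 1"
    and X: "stochastic_integral M Y h X"
  shows "(\<integral>\<^sup>+ \<omega>. ennreal (exp (c * (sqrt (real n) * \<bar>X \<omega> - (\<integral>x. f x * h x \<partial>unit_interval)\<bar>))) \<partial>M)
    \<le> ennreal (2 * exp (c\<^sup>2 / 2))"
proof -
  have [measurable]: "X \<in> borel_measurable M"
    using X by (simp add: stochastic_integral_def)
  define Z where "Z \<omega> = sqrt (real n) * (X \<omega> - (\<integral>x. f x * h x \<partial>unit_interval))" for \<omega>
  have [measurable]: "Z \<in> borel_measurable M"
    unfolding Z_def by measurable
  have le: "(\<integral>\<^sup>+ \<omega>. ennreal (exp (c' * Z \<omega>)) \<partial>M) \<le> ennreal (exp (c'\<^sup>2 / 2))" for c'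
    using stochastic_integral_subgaussian[OF bm n f h X, of c'] by (simp add: Z_def norm)
  have "(\<integral>\<^sup>+ \<omega>. ennreal (exp (c * \<bar>Z \<omega>\<bar>)) \<partial>M)
      \<le> (\<integral>\<^sup>+ \<omega>. ennreal (exp (c * Z \<omega>)) + ennreal (exp (- c * Z \<omega>)) \<partial>M)"
    by (intro nn_integral_mono) (auto simp: abs_if)
  also have "\<dots> = (\<integral>\<^sup>+ \<omega>. ennreal (exp (c * Z \<omega>)) \<partial>M) + (\<integral>\<^sup>+ \<omega>. ennreal (exp (- c * Z \<omega>)) \<partial>M)"
    by (rule nn_integral_add) simp_all
  also have "\<dots> \<le> ennreal (exp (c\<^sup>2 / 2)) + ennreal (exp ((- c)\<^sup>2 / 2))"
    by (intro add_mono le)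
  also have "\<dots> = ennreal (2 * exp (c\<^sup>2 / 2))"
    by (simp flip: ennreal_plus)
  finally show ?thesis
    by (simp add: Z_def abs_mult)
qed


section \<open>Norms on a resolution level\<close>

lemma one_le_enn2real: "1 \<le> enn2real p" if "1 \<le> p" "p < \<infinity>"
  using that by (metis enn2real_1 enn2real_mono infinity_ennreal_def)

lemma Lp_norm_count_space:
  assumes "finite A" and "1 \<le> p" and "p < \<infinity>"
  shows "Lp_norm (count_space A) p d =
    ennreal ((\<Sum>k\<in>A. \<bar>d k\<bar> powr enn2real p) powr (1 / enn2real p))"
proof -
  have "(\<integral>\<^sup>+ k. ennreal (\<bar>d k\<bar> powr enn2real p) \<partial>count_space A) =
      ennreal (\<Sum>k\<in>A. \<bar>d k\<bar> powr enn2real p)"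
    using assms(1) by (simp add: nn_integral_count_space_finite sum_ennreal)
  with assms show ?thesis
    by (simp add: Lp_norm_def sum_nonneg less_top[symmetric])
qed

lemma inv_exponent_finite: "inv_exponent p = 1 / enn2real p" if "1 \<le> p" "p < \<infinity>"
  using that
  by (cases p) (auto simp: inv_exponent_def inverse_ennreal divide_inverse ennreal_le_iff2)

lemma inv_exponent_top [simp]: "inv_exponent top = 0"
  by (simp add: inv_exponent_def)

lemma inv_exponent_bounds:
  assumes "1 \<le> p"
  shows "0 \<le> inv_exponent p" "inv_exponent p \<le> 1"
proof -
  show "0 \<le> inv_exponent p"
    by (simp add: inv_exponent_def)
  show "inv_exponent p \<le> 1"
  proof (cases "p = \<infinity>")
    case False
    then have "p < \<infinity>"
      by (simp add: less_top)
    with assms one_le_enn2real[OF assms this] show ?thesis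
      by (simp add: inv_exponent_finite)
  qed simp
qed

text \<open>For \<open>p = \<infinity>\<close> the exponent of \<open>D\<close> is 0, and
  \<open>0 < D\<close> is needed for the factor to be 1, since \<open>0 powr 0 = 0\<close>.\<close>

lemma Lp_norm_count_space_le_max:
  assumes "finite A" and "1 \<le> p" and d: "\<And>k. k \<in> A \<Longrightarrow> \<bar>d k\<bar> \<le> b" and b: "0 \<le> b"
    and card: "real (card A) \<le> D" and D: "0 < D"
  shows "Lp_norm (count_space A) p d \<le> ennreal (D powr inv_exponent p * b)"
proof (cases "p = \<infinity>")
  case True
  have "esssup (count_space A) (\<lambda>k. ennreal \<bar>d k\<bar>) \<le> ennreal b"
    by (rule esssup_I) (use d in \<open>auto simp: AE_count_space intro!: ennreal_leI\<close>)
  then show ?thesis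
    using True D by (simp add: Lp_norm_def)
next
  case False
  then have fin: "p < \<infinity>"
    by (simp add: less_top)
  define P where "P = enn2real p"
  have P: "1 \<le> P"
    unfolding P_def by (rule one_le_enn2real[OF assms(2) fin])
  have "(\<Sum>k\<in>A. \<bar>d k\<bar> powr P) \<le> (\<Sum>k\<in>A. b powr P)"
    using d P by (intro sum_mono powr_mono2) auto
  also have "\<dots> \<le> D * b powr P"
    using card by (simp add: mult_right_mono)
  finally have "(\<Sum>k\<in>A. \<bar>d k\<bar> powr P) powr (1 / P) \<le> (D * b powr P) powr (1 / P)"
    using P by (intro powr_mono2) (auto simp: sum_nonneg)
  also have "\<dots> = D powr (1 / P) * b"
    using P b D by (simp add: powr_mult powr_powr)
  finally show ?thesis
    using Lp_norm_count_space[OF assms(1,2) fin, of d] inv_exponent_finite[OF assms(2) fin]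
    by (simp add: P_def ennreal_leI)
qed

text \<open>Apply \<open>u \<le> exp u\<close> to \<open>u = x / P\<close> and raise it to the power
  \<open>P\<close>.\<close>

lemma powr_le_exp:
  fixes x P :: real
  assumes "0 < P" "0 \<le> x"
  shows "x powr P \<le> P powr P * exp x"
proof -
  have "x / P \<le> exp (x / P)"
    using exp_ge_add_one_self[of "x / P"] by linarith
  then have "(x / P) powr P \<le> exp (x / P) powr P"
    using assms by (intro powr_mono2) auto
  with assms show ?thesis
    by (simp add: powr_divide powr_def[of "exp _"] field_simps)
qed

text \<open>The root of the power sum is replaced by an affine bound, and powers by exponentials, so
  that the right-hand side can be averaged using exponential moments alone.\<close>

lemma Lp_norm_count_space_le_exp_sum:
  assumes "finite A" and "1 \<le> p" and fin: "p < \<infinity>"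
    and d: "\<And>k. k \<in> A \<Longrightarrow> \<bar>d k\<bar> \<le> \<sigma> * z k" and "0 < \<sigma>" and "0 < D"
  shows "Lp_norm (count_space A) p d \<le> ennreal (D powr inv_exponent p * \<sigma> *
    (1 + enn2real p powr enn2real p / D * (\<Sum>k\<in>A. exp (z k))))"
proof -
  define P where "P = enn2real p"
  have P: "1 \<le> P"
    unfolding P_def by (rule one_le_enn2real[OF assms(2) fin])
  define S where "S = (\<Sum>k\<in>A. \<bar>d k\<bar> powr P)"
  \<comment> \<open>\<open>T\<close> is the size of \<open>S\<close> when \<open>D\<close> entries
    all have order \<open>\<sigma>\<close>; the ratio \<open>S / T\<close> is thus of constant order
    on average.\<close>
  define T where "T = D * \<sigma> powr P"
  have T: "0 < T"
    using \<open>0 < \<sigma>\<close> \<open>0 < D\<close> by (simp add: T_def)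
  have "S \<ge> 0"
    by (simp add: S_def sum_nonneg)
  have "(S / T) powr (1 / P) \<le> 1 + S / T"
  proof (cases "S / T \<le> 1")
    case True
    then have "(S / T) powr (1 / P) \<le> 1"
      using P T \<open>S \<ge> 0\<close> by (intro powr_le1) auto
    moreover have "0 \<le> S / T"
      using T \<open>S \<ge> 0\<close> by simp
    ultimately show ?thesis
      by linarith
  next
    case False
    then have "(S / T) powr (1 / P) \<le> (S / T) powr 1"
      using P by (intro powr_mono) auto
    with False show ?thesis
      by simp
  qed
  moreover have "S powr (1 / P) = T powr (1 / P) * (S / T) powr (1 / P)"
    using T \<open>S \<ge> 0\<close> by (simp flip: powr_mult)
  ultimately have "S powr (1 / P) \<le> T powr (1 / P) * (1 + S / T)"
    by (simp add: mult_left_mono)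
  also have "T powr (1 / P) = D powr (1 / P) * \<sigma>"
    using P \<open>0 < \<sigma>\<close> \<open>0 < D\<close> by (simp add: T_def powr_mult powr_powr)
  also have "S \<le> \<sigma> powr P * (P powr P * (\<Sum>k\<in>A. exp (z k)))"
    unfolding S_def sum_distrib_left
  proof (rule sum_mono)
    fix k assume k: "k \<in> A"
    have "0 \<le> \<sigma> * z k"
      using d[OF k] abs_ge_zero[of "d k"] by linarith
    then have z: "0 \<le> z k"
      using \<open>0 < \<sigma>\<close> by (simp add: zero_le_mult_iff)
    have "\<bar>d k\<bar> powr P \<le> (\<sigma> * z k) powr P"
      using d[OF k] P by (intro powr_mono2) auto
    also have "\<dots> = \<sigma> powr P * z k powr P"
      using z \<open>0 < \<sigma>\<close> by (simp add: powr_mult)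
    also have "\<dots> \<le> \<sigma> powr P * (P powr P * exp (z k))"
      using P z by (intro mult_left_mono powr_le_exp) auto
    finally show "\<bar>d k\<bar> powr P \<le> \<sigma> powr P * (P powr P * exp (z k))" .
  qed
  then have "S / T \<le> P powr P / D * (\<Sum>k\<in>A. exp (z k))"
    using T \<open>0 < \<sigma>\<close> \<open>0 < D\<close> by (simp add: T_def field_simps)
  then have "D powr (1 / P) * \<sigma> * (1 + S / T) \<le>
      D powr (1 / P) * \<sigma> * (1 + P powr P / D * (\<Sum>k\<in>A. exp (z k)))"
    using \<open>0 < \<sigma>\<close> by (intro mult_left_mono) auto
  finally show ?thesis
    using Lp_norm_count_space[OF assms(1,2) fin, of d] inv_exponent_finite[OF assms(2) fin]
    by (simp add: P_def S_def ennreal_leI)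
qed

text \<open>
  For \<open>z = 2 l + u\<close> with \<open>u \<ge> 0\<close> one has \<open>u \<le> exp (l u)\<close>; the threshold \<open>2 l\<close> makes the
  exponential moments \<open>2 exp (l\<^sup>2 / 2)\<close> of the noise negligible.
\<close>

lemma Lp_norm_count_space_infinity_le_exp_sum:
  assumes "finite A" and d: "\<And>k. k \<in> A \<Longrightarrow> \<bar>d k\<bar> \<le> \<sigma> * z k" and "0 < \<sigma>" and l: "1 \<le> l"
  shows "Lp_norm (count_space A) \<infinity> d \<le>
    ennreal (\<sigma> * (2 * l + exp (- 2 * l\<^sup>2) * (\<Sum>k\<in>A. exp (l * z k))))"
proof -
  have "\<bar>d k\<bar> \<le> \<sigma> * (2 * l + exp (- 2 * l\<^sup>2) * (\<Sum>k\<in>A. exp (l * z k)))" if k: "k \<in> A" for k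
  proof -
    have "exp (l * (z k - 2 * l)) \<le> exp (- 2 * l\<^sup>2) * (\<Sum>k\<in>A. exp (l * z k))"
    proof -
      have "exp (l * (z k - 2 * l)) = exp (- 2 * l\<^sup>2) * exp (l * z k)"
        by (simp add: power2_eq_square algebra_simps flip: exp_add)
      also have "\<dots> \<le> exp (- 2 * l\<^sup>2) * (\<Sum>k\<in>A. exp (l * z k))"
        using assms(1) k by (intro mult_left_mono member_le_sum) auto
      finally show ?thesis .
    qed
    moreover have "z k - 2 * l \<le> exp (l * (z k - 2 * l))"
    proof (cases "z k - 2 * l \<le> 0")
      case True
      then show ?thesis
        using exp_gt_zero[of "l * (z k - 2 * l)"] by linarith
    next
      case False
      then have "z k - 2 * l \<le> l * (z k - 2 * l)"
        using l by (simp add: mult_le_cancel_right1)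
      then show ?thesis
        using exp_ge_add_one_self[of "l * (z k - 2 * l)"] by linarith
    qed
    ultimately have "z k \<le> 2 * l + exp (- 2 * l\<^sup>2) * (\<Sum>k\<in>A. exp (l * z k))"
      by linarith
    then have "\<sigma> * z k \<le> \<sigma> * (2 * l + exp (- 2 * l\<^sup>2) * (\<Sum>k\<in>A. exp (l * z k)))"
      using \<open>0 < \<sigma>\<close> by (intro mult_left_mono) auto
    with d[OF k] show ?thesis
      by linarith
  qed
  then have "esssup (count_space A) (\<lambda>k. ennreal \<bar>d k\<bar>) \<le>
      ennreal (\<sigma> * (2 * l + exp (- 2 * l\<^sup>2) * (\<Sum>k\<in>A. exp (l * z k))))"
    by (intro esssup_I) (auto simp: AE_count_space intro!: ennreal_leI)
  then show ?thesis
    by (simp add: Lp_norm_def)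
qed

text \<open>Both norm bounds for noise are affine in a sum of exponentials, so linearity carries the
  expectation inside and only individual moments enter. No independence between the indices is
  involved.\<close>

lemma nn_integral_affine_exp_sum:
  assumes "prob_space M" and "finite A" and Z: "\<And>k. k \<in> A \<Longrightarrow> Z k \<in> borel_measurable M"
    and mom: "\<And>k. k \<in> A \<Longrightarrow> (\<integral>\<^sup>+ \<omega>. ennreal (exp (l * Z k \<omega>)) \<partial>M) \<le> ennreal m"
    and "0 \<le> a" "0 \<le> b" "0 \<le> c" "0 \<le> m"
  shows "(\<integral>\<^sup>+ \<omega>. ennreal (a * (b + c * (\<Sum>k\<in>A. exp (l * Z k \<omega>)))) \<partial>M) \<le>
    ennreal (a * (b + c * (real (card A) * m)))"
proof -
  interpret prob_space M by fact
  have [measurable]: "(\<lambda>\<omega>. ennreal (\<Sum>k\<in>A. exp (l * Z k \<omega>))) \<in> borel_measurable M"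
    using Z by measurable
  have "(\<integral>\<^sup>+ \<omega>. ennreal (a * (b + c * (\<Sum>k\<in>A. exp (l * Z k \<omega>)))) \<partial>M) =
      (\<integral>\<^sup>+ \<omega>. ennreal a * (ennreal b + ennreal c * ennreal (\<Sum>k\<in>A. exp (l * Z k \<omega>))) \<partial>M)"
    using assms by (simp add: ennreal_mult sum_nonneg)
  also have "\<dots> = ennreal a * (ennreal b + ennreal c *
      (\<integral>\<^sup>+ \<omega>. ennreal (\<Sum>k\<in>A. exp (l * Z k \<omega>)) \<partial>M))"
    by (simp add: nn_integral_cmult nn_integral_add emeasure_space_1)
  also have "(\<integral>\<^sup>+ \<omega>. ennreal (\<Sum>k\<in>A. exp (l * Z k \<omega>)) \<partial>M) =
      (\<Sum>k\<in>A. \<integral>\<^sup>+ \<omega>. ennreal (exp (l * Z k \<omega>)) \<partial>M)"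
    using Z by (simp add: nn_integral_sum flip: sum_ennreal)
  also have "\<dots> \<le> (\<Sum>k\<in>A. ennreal m)"
    by (rule sum_mono) (rule mom)
  also have "\<dots> = ennreal (real (card A) * m)"
    using assms by (simp add: ennreal_of_nat_eq_real_of_nat ennreal_mult)
  also have "ennreal a * (ennreal b + ennreal c * ennreal (real (card A) * m)) =
      ennreal (a * (b + c * (real (card A) * m)))"
    using assms by (simp add: ennreal_mult)
  finally show ?thesis
    by (simp add: mult_left_mono add_left_mono)
qed

section \<open>Clipping and a two-sided geometric series\<close>

lemma abs_clipped_coef_le: "0 \<le> Q \<Longrightarrow> \<bar>clipped_coef \<beta> Q j v\<bar> \<le> coef_bound \<beta> Q j"
  by (auto simp: clipped_coef_def coef_bound_def abs_mult abs_sgn_eq)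

text \<open>Clipping is the projection onto a symmetric interval containing \<open>d\<close>, and a
  projection onto an interval moves no point away from the points of that interval.\<close>

lemma clipped_coef_contract:
  assumes "\<bar>d\<bar> \<le> coef_bound \<beta> Q j"
  shows "\<bar>clipped_coef \<beta> Q j v - d\<bar> \<le> \<bar>v - d\<bar>"
  using assms by (auto simp: clipped_coef_def sgn_real_def min_def)

text \<open>On each side of \<open>m\<close> every distance occurs at most once, so each side is
  dominated by the full geometric series.\<close>

lemma suminf_geometric_abs_le:
  fixes q :: real and m :: int
  assumes q: "0 \<le> q" "q < 1"
  shows "(\<Sum>i. ennreal (q ^ nat \<bar>int i - m\<bar>)) \<le> ennreal (2 / (1 - q))"
proof -
  have half: "(\<Sum>i\<in>B. q ^ g i) \<le> 1 / (1 - q)" if "finite B" "inj_on g B" for g :: "nat \<Rightarrow> nat" and B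
  proof -
    have "(\<Sum>i\<in>B. q ^ g i) = (\<Sum>k\<in>g ` B. q ^ k)"
      using that(2) by (simp add: sum.reindex)
    also have "\<dots> \<le> (\<Sum>k. q ^ k)"
      using q that by (intro sum_le_suminf summable_geometric) auto
    also have "\<dots> = 1 / (1 - q)"
      using q by (simp add: suminf_geometric)
    finally show ?thesis .
  qed
  have "(\<Sum>i<n. ennreal (q ^ nat \<bar>int i - m\<bar>)) \<le> ennreal (2 / (1 - q))" for n
  proof -
    have "(\<Sum>i<n. q ^ nat \<bar>int i - m\<bar>) =
        (\<Sum>i\<in>{i. i < n \<and> int i < m}. q ^ nat \<bar>int i - m\<bar>) +
        (\<Sum>i\<in>{i. i < n \<and> \<not> int i < m}. q ^ nat \<bar>int i - m\<bar>)"
      by (subst sum.union_disjoint[symmetric]) (auto intro!: sum.cong)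
    also have "\<dots> \<le> 1 / (1 - q) + 1 / (1 - q)"
      by (intro add_mono half) (auto simp: inj_on_def)
    finally show ?thesis
      using q by (simp add: ennreal_leI)
  qed
  then show ?thesis
    by (intro suminf_le_const) auto
qed

section \<open>Expected size of the noise on one level\<close>

text \<open>The bound is stated through a majorant \<open>G\<close> that is measurable by
  construction, so that the expectation can later be exchanged with the sum over the levels. The
  parameter \<open>l\<close> is the price of a maximum over the level and enters the bound only for
  \<open>p = \<infinity>\<close>.\<close>

lemma level_noise_bound:
  assumes M: "prob_space M" and A: "finite A" and p: "1 \<le> p"
    and D: "0 < D" and card: "real (card A) \<le> \<Gamma> * D" and \<Gamma>: "0 \<le> \<Gamma>" and \<sigma>: "0 < \<sigma>"
    and Z: "\<And>k. k \<in> A \<Longrightarrow> Z k \<in> borel_measurable M"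
    and mom: "\<And>k c. k \<in> A \<Longrightarrow>
      (\<integral>\<^sup>+ \<omega>. ennreal (exp (c * Z k \<omega>)) \<partial>M) \<le> ennreal (2 * exp (c\<^sup>2 / 2))"
    and e: "\<And>k \<omega>. k \<in> A \<Longrightarrow> \<bar>e k \<omega>\<bar> \<le> \<sigma> * Z k \<omega>"
    and l: "1 \<le> l" and Dl: "p = \<infinity> \<Longrightarrow> D * exp (- (3 / 2) * l\<^sup>2) \<le> 1"
    and K: "K = (if p = \<infinity> then 2 + 2 * \<Gamma>
      else 1 + enn2real p powr enn2real p * (\<Gamma> * (2 * exp (1 / 2))))"
  shows "\<exists>G \<in> borel_measurable M.
    (\<forall>\<omega>. Lp_norm (count_space A) p (\<lambda>k. e k \<omega>) \<le> G \<omega>) \<and>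
    (\<integral>\<^sup>+ \<omega>. G \<omega> \<partial>M) \<le> ennreal (D powr inv_exponent p * (\<sigma> * (if p = \<infinity> then l else 1)) * K)"
proof (cases "p = \<infinity>")
  case True
  define G where "G \<omega> = ennreal (\<sigma> * (2 * l + exp (- 2 * l\<^sup>2) * (\<Sum>k\<in>A. exp (l * Z k \<omega>))))" for \<omega>
  have "G \<in> borel_measurable M"
    unfolding G_def using Z by measurable
  moreover have "Lp_norm (count_space A) p (\<lambda>k. e k \<omega>) \<le> G \<omega>" for \<omega>
    unfolding G_def True
    by (rule Lp_norm_count_space_infinity_le_exp_sum[OF A _ \<sigma> l]) (rule e)
  moreover have "(\<integral>\<^sup>+ \<omega>. G \<omega> \<partial>M) \<le>
      ennreal (\<sigma> * (2 * l + exp (- 2 * l\<^sup>2) * (real (card A) * (2 * exp (l\<^sup>2 / 2)))))"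
    unfolding G_def
    by (rule nn_integral_affine_exp_sum[OF M A Z mom]) (use \<sigma> l in auto)
  moreover have "\<sigma> * (2 * l + exp (- 2 * l\<^sup>2) * (real (card A) * (2 * exp (l\<^sup>2 / 2)))) \<le>
      D powr inv_exponent p * (\<sigma> * (if p = \<infinity> then l else 1)) * K"
  proof -
    \<comment> \<open>The threshold contributes \<open>- 2\<close> and the moment
      \<open>1 / 2\<close> to the coefficient of \<open>l\<^sup>2\<close>; the result
      \<open>- 3 / 2\<close> is what \<open>Dl\<close> compares with the size of the level.\<close>
    have "exp (- 2 * l\<^sup>2) * exp (l\<^sup>2 / 2) = exp (- (3 / 2) * l\<^sup>2)"
      by (simp flip: exp_add)
    then have "exp (- 2 * l\<^sup>2) * (real (card A) * (2 * exp (l\<^sup>2 / 2))) =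
        2 * (real (card A) * exp (- (3 / 2) * l\<^sup>2))"
      by (metis mult.assoc mult.left_commute)
    also have "\<dots> \<le> 2 * (\<Gamma> * D * exp (- (3 / 2) * l\<^sup>2))"
      using card by (intro mult_left_mono mult_right_mono) auto
    also have "\<dots> = 2 * (\<Gamma> * (D * exp (- (3 / 2) * l\<^sup>2)))"
      by simp
    also have "\<dots> \<le> 2 * (\<Gamma> * 1)"
      using Dl[OF True] \<Gamma> by (intro mult_left_mono) auto
    \<comment> \<open>Since \<open>1 \<le> l\<close>, the remainder can share the factor
      \<open>l\<close> of the main term.\<close>
    also have "\<dots> \<le> 2 * \<Gamma> * l"
      using mult_left_mono[OF l \<Gamma>] by simp
    finally have "\<sigma> * (2 * l + exp (- 2 * l\<^sup>2) * (real (card A) * (2 * exp (l\<^sup>2 / 2)))) \<le>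
        \<sigma> * (2 * l + 2 * \<Gamma> * l)"
      using \<sigma> by (intro mult_left_mono) auto
    also have "\<dots> = D powr inv_exponent p * (\<sigma> * (if p = \<infinity> then l else 1)) * K"
      using True D by (simp add: K algebra_simps)
    finally show ?thesis .
  qed
  ultimately show ?thesis
    by (meson ennreal_leI order_trans)
next
  case False
  then have fin: "p < \<infinity>"
    by (simp add: less_top)
  define c where "c = enn2real p powr enn2real p"
  have c: "0 \<le> c"
    by (simp add: c_def)
  \<comment> \<open>For finite \<open>p\<close> the moment at parameter 1 is enough; it contributes
    the factor \<open>2 * exp (1 / 2)\<close> of \<open>K\<close>.\<close>
  define G where "G \<omega> = ennreal (D powr inv_exponent p * \<sigma> *
    (1 + c / D * (\<Sum>k\<in>A. exp (1 * Z k \<omega>))))" for \<omega>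
  have "G \<in> borel_measurable M"
    unfolding G_def using Z by measurable
  moreover have "Lp_norm (count_space A) p (\<lambda>k. e k \<omega>) \<le> G \<omega>" for \<omega>
    unfolding G_def c_def mult_1
    by (rule Lp_norm_count_space_le_exp_sum[OF A p fin _ \<sigma> D]) (rule e)
  moreover have "(\<integral>\<^sup>+ \<omega>. G \<omega> \<partial>M) \<le>
      ennreal (D powr inv_exponent p * \<sigma> * (1 + c / D * (real (card A) * (2 * exp (1\<^sup>2 / 2)))))"
    unfolding G_def
    by (rule nn_integral_affine_exp_sum[OF M A Z mom]) (use \<sigma> c D in auto)
  moreover have "D powr inv_exponent p * \<sigma> * (1 + c / D * (real (card A) * (2 * exp (1\<^sup>2 / 2)))) \<le>
      D powr inv_exponent p * (\<sigma> * (if p = \<infinity> then l else 1)) * K"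
  proof -
    have "c / D * (real (card A) * (2 * exp (1\<^sup>2 / 2))) \<le> c / D * (\<Gamma> * D * (2 * exp (1\<^sup>2 / 2)))"
      using card c D by (intro mult_left_mono mult_right_mono) auto
    also have "\<dots> = c * (\<Gamma> * (2 * exp (1 / 2)))"
      using D by simp
    finally show ?thesis
      using False \<sigma> by (simp add: K c_def mult_left_mono)
  qed
  ultimately show ?thesis
    by (meson ennreal_leI order_trans)
qed

section \<open>Summation over the levels\<close>

text \<open>The noise bound grows up to \<open>L\<close> and the smoothness bound decays after it.
  At \<open>L\<close> both have the order of the rate, for instance because \<open>1 / (2 * (2 *
  \<beta> + 1)) - 1 / 2 = - \<beta> / (2 * \<beta> + 1)\<close>. Away from \<open>L\<close> they
  shrink by the factors \<open>2 powr (- (1 / 2))\<close> and \<open>2 powr (- \<beta>)\<close> per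
  level, the slower of which is \<open>q\<close>.\<close>

lemma suminf_rate_bound:
  fixes \<beta> N c K K' :: real and L :: int
  assumes \<beta>: "0 < \<beta>" and N: "1 \<le> N" and c: "0 < c" and K: "0 \<le> K" "0 \<le> K'"
    and upper: "2 powr L \<le> N powr (1 / (2 * \<beta> + 1))"
    and lower: "c * N powr (1 / (2 * \<beta> + 1)) \<le> 2 powr L"
    and q: "q = max (2 powr (- (1 / 2))) (2 powr (- \<beta>))"
  shows "(\<Sum>i. let j = int i - 1 in ennreal (if j \<le> L then K * (2 powr (j / 2) * N powr (- (1 / 2)))
      else K' * 2 powr (- \<beta> * j))) \<le>
    ennreal (max K (K' * c powr (- \<beta>)) * (2 / (1 - q)) * N powr (- \<beta> / (2 * \<beta> + 1)))"
    (is "(\<Sum>i. ?g i) \<le> _")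
proof -
  define R where "R = max K (K' * c powr (- \<beta>)) * N powr (- \<beta> / (2 * \<beta> + 1))"
  have R: "0 \<le> R"
    using K by (simp add: R_def)
  have q01: "0 \<le> q" "q < 1"
    using \<beta> by (auto simp: q max_def powr_less_one)
  have "?g i \<le> ennreal R * ennreal (q ^ nat \<bar>int i - (L + 1)\<bar>)" for i
  proof -
    define j where "j = int i - 1"
    \<comment> \<open>The distance of \<open>j\<close> from \<open>L\<close>; the summation index is
      \<open>i = j + 1\<close>, hence \<open>L + 1\<close>.\<close>
    define r where "r = nat \<bar>int i - (L + 1)\<bar>"
    have "(if j \<le> L then K * (2 powr (j / 2) * N powr (- (1 / 2))) else K' * 2 powr (- \<beta> * j)) \<le> R * q ^ r"
    proof (cases "j \<le> L")
      case True
      then have jr: "real_of_int j = L - real r"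
        by (simp add: r_def j_def)
      have "2 powr (j / 2) * N powr (- (1 / 2)) =
          ((2 powr L) powr (1 / 2) * N powr (- (1 / 2))) * (2 powr (- (1 / 2))) ^ r"
        by (simp add: jr powr_powr algebra_simps diff_divide_distrib flip: powr_realpow powr_add)
      also have "\<dots> \<le> ((N powr (1 / (2 * \<beta> + 1))) powr (1 / 2) * N powr (- (1 / 2))) * q ^ r"
        using upper by (intro mult_mono power_mono order_refl powr_mono2) (auto simp: q)
      also have "(N powr (1 / (2 * \<beta> + 1))) powr (1 / 2) * N powr (- (1 / 2)) =
          N powr (- \<beta> / (2 * \<beta> + 1))"
      proof -
        have "1 / (2 * \<beta> + 1) * (1 / 2) + - (1 / 2) = - \<beta> / (2 * \<beta> + 1)"
          using \<beta> by (simp add: field_simps)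
        then show ?thesis
          by (simp only: powr_powr powr_add[symmetric])
      qed
      finally have "2 powr (j / 2) * N powr (- (1 / 2)) \<le> N powr (- \<beta> / (2 * \<beta> + 1)) * q ^ r" .
      then have "K * (2 powr (j / 2) * N powr (- (1 / 2))) \<le>
          max K (K' * c powr (- \<beta>)) * (N powr (- \<beta> / (2 * \<beta> + 1)) * q ^ r)"
        by (rule mult_mono[rotated]) (use K in auto)
      with True show ?thesis
        by (simp add: R_def mult.assoc)
    next
      case False
      then have jr: "real_of_int j = L + real r"
        by (simp add: r_def j_def)
      have "2 powr (- \<beta> * j) = (2 powr L) powr (- \<beta>) * (2 powr (- \<beta>)) ^ r"
        by (simp add: jr powr_powr algebra_simps flip: powr_realpow powr_add)
      \<comment> \<open>The exponent \<open>- \<beta>\<close> reverses the order, so above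
        \<open>L\<close> it is the lower bound on \<open>2 powr L\<close> that enters, and
        \<open>c\<close> appears with a negative power.\<close>
      also have "\<dots> \<le> (c * N powr (1 / (2 * \<beta> + 1))) powr (- \<beta>) * q ^ r"
        using lower c N \<beta> by (intro mult_mono power_mono powr_mono2') (auto simp: q)
      also have "(c * N powr (1 / (2 * \<beta> + 1))) powr (- \<beta>) =
          c powr (- \<beta>) * N powr (- \<beta> / (2 * \<beta> + 1))"
        using c by (simp add: powr_mult powr_powr)
      finally have "K' * 2 powr (- \<beta> * j) \<le> (K' * c powr (- \<beta>)) * (N powr (- \<beta> / (2 * \<beta> + 1)) * q ^ r)"
        using K by (simp add: mult_left_mono mult.assoc)
      also have "\<dots> \<le> max K (K' * c powr (- \<beta>)) * (N powr (- \<beta> / (2 * \<beta> + 1)) * q ^ r)"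
        using q01 by (intro mult_right_mono) auto
      finally show ?thesis
        using False by (simp add: R_def mult.assoc)
    qed
    then have "ennreal (if j \<le> L then K * (2 powr (j / 2) * N powr (- (1 / 2)))
        else K' * 2 powr (- \<beta> * j)) \<le> ennreal (R * q ^ r)"
      by (rule ennreal_leI)
    also have "\<dots> = ennreal R * ennreal (q ^ r)"
      using R q01 by (simp add: ennreal_mult)
    finally show ?thesis
      by (simp only: Let_def j_def r_def)
  qed
  then have "(\<Sum>i. ?g i) \<le> (\<Sum>i. ennreal R * ennreal (q ^ nat \<bar>int i - (L + 1)\<bar>))"
    by (intro suminf_le) auto
  also have "\<dots> = ennreal R * (\<Sum>i. ennreal (q ^ nat \<bar>int i - (L + 1)\<bar>))"
    by simp
  also have "\<dots> \<le> ennreal R * ennreal (2 / (1 - q))"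
    by (intro mult_left_mono suminf_geometric_abs_le q01) simp
  also have "\<dots> = ennreal (max K (K' * c powr (- \<beta>)) * (2 / (1 - q)) * N powr (- \<beta> / (2 * \<beta> + 1)))"
    using R q01 by (simp add: R_def algebra_simps flip: ennreal_mult)
  finally show ?thesis .
qed

text \<open>Take the integer part of the binary logarithm of \<open>N powr \<gamma>\<close>, capped
  at \<open>J\<close>. Rounding costs at most the factor 1/2, and the cap at most the factor
  \<open>c\<close>, because \<open>N \<le> n\<close>.\<close>

lemma threshold_level_exists:
  fixes N n \<gamma> c :: real and J :: int
  assumes "1 \<le> N" "N \<le> n" "0 < \<gamma>" "0 < c" "c * n powr \<gamma> \<le> 2 powr J"
  shows "\<exists>L \<le> J. 2 powr L \<le> N powr \<gamma> \<and> min c (1 / 2) * N powr \<gamma> \<le> 2 powr (real_of_int L)"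
proof -
  define x where "x = log 2 (N powr \<gamma>)"
  have x: "2 powr x = N powr \<gamma>"
    using assms by (simp add: x_def)
  define L where "L = min J \<lfloor>x\<rfloor>"
  have "2 powr L \<le> 2 powr x"
    by (intro powr_mono) (auto simp: L_def min_le_iff_disj le_floor_iff[symmetric])
  moreover have "min c (1 / 2) * N powr \<gamma> \<le> 2 powr (real_of_int L)"
  proof (cases "J \<le> \<lfloor>x\<rfloor>")
    case True
    have "min c (1 / 2) * N powr \<gamma> \<le> c * n powr \<gamma>"
      using assms by (intro mult_mono powr_mono2) auto
    with True assms(5) show ?thesis
      by (simp add: L_def)
  next
    case False
    have "min c (1 / 2) * N powr \<gamma> \<le> 1 / 2 * 2 powr x"
      unfolding x by (intro mult_right_mono) auto
    also have "\<dots> = 2 powr (x - 1)"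
      by (simp add: powr_diff)
    also have "\<dots> \<le> 2 powr (real_of_int \<lfloor>x\<rfloor>)"
      by (intro powr_mono) linarith+
    finally show ?thesis
      using False by (simp add: L_def min_def)
  qed
  ultimately show ?thesis
    using x by (intro exI[of _ L]) (auto simp: L_def)
qed

section \<open>Risk bound for a fixed sample size\<close>

text \<open>The estimator is a finite expansion, so beyond level \<open>J\<close> the remainder of
  the error series is the negative of the remainder of the series of \<open>f\<close>, which has the
  same norm.\<close>

lemma wavelet_series_estimation_error:
  assumes series: "wavelet_series I w d f"
    and onb: "orthonormal_basis unit_interval (SIGMA j:{-1..}. I j) (\<lambda>(j, k). w j k)"
  shows "wavelet_series I w
    (\<lambda>j k. (if j \<le> J then clipped_coef \<beta> Q j (y j k \<omega>) else 0) - d j k)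
    (\<lambda>x. estimator I w \<beta> Q J y \<omega> x - f x)"
proof -
  have w: "w j k \<in> square_integrable unit_interval" if "j \<ge> -1" "k \<in> I j" for j k
    using onb that by (auto simp: orthonormal_basis_def)
  have "(\<lambda>x. estimator I w \<beta> Q J y \<omega> x) \<in> square_integrable unit_interval"
    unfolding estimator_def by (intro square_integrable_sum square_integrable_cmult w) auto
  moreover have "f \<in> square_integrable unit_interval"
    using series by (simp add: wavelet_series_def)
  ultimately have sq: "(\<lambda>x. estimator I w \<beta> Q J y \<omega> x - f x) \<in> square_integrable unit_interval"
    by (rule square_integrable_diff)
  have "(\<lambda>N::nat. Lp_norm unit_interval 2
      (\<lambda>x. f x - (\<Sum>j\<in>{-1..int N}. \<Sum>k\<in>I j. d j k * w j k x))) \<longlonglongrightarrow> 0"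
    using series by (simp add: wavelet_series_def)
  moreover have "\<forall>\<^sub>F N in sequentially.
      Lp_norm unit_interval 2 (\<lambda>x. f x - (\<Sum>j\<in>{-1..int N}. \<Sum>k\<in>I j. d j k * w j k x)) =
      Lp_norm unit_interval 2 (\<lambda>x. (estimator I w \<beta> Q J y \<omega> x - f x) - (\<Sum>j\<in>{-1..int N}. \<Sum>k\<in>I j.
        ((if j \<le> J then clipped_coef \<beta> Q j (y j k \<omega>) else 0) - d j k) * w j k x))"
  proof (rule eventually_sequentiallyI[of "nat J"])
    fix N assume N: "nat J \<le> N"
    have "(\<Sum>j\<in>{-1..int N}. \<Sum>k\<in>I j. (if j \<le> J then clipped_coef \<beta> Q j (y j k \<omega>) else 0) * w j k x) =
        estimator I w \<beta> Q J y \<omega> x" for x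
      unfolding estimator_def by (rule sum.mono_neutral_cong_right) (use N in auto)
    then have "(\<lambda>x. (estimator I w \<beta> Q J y \<omega> x - f x) - (\<Sum>j\<in>{-1..int N}. \<Sum>k\<in>I j.
        ((if j \<le> J then clipped_coef \<beta> Q j (y j k \<omega>) else 0) - d j k) * w j k x)) =
        (\<lambda>x. - (f x - (\<Sum>j\<in>{-1..int N}. \<Sum>k\<in>I j. d j k * w j k x)))"
      by (simp add: left_diff_distrib sum_subtractf)
    then show "Lp_norm unit_interval 2 (\<lambda>x. f x - (\<Sum>j\<in>{-1..int N}. \<Sum>k\<in>I j. d j k * w j k x)) =
      Lp_norm unit_interval 2 (\<lambda>x. (estimator I w \<beta> Q J y \<omega> x - f x) - (\<Sum>j\<in>{-1..int N}. \<Sum>k\<in>I j.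
        ((if j \<le> J then clipped_coef \<beta> Q j (y j k \<omega>) else 0) - d j k) * w j k x))"
      by (simp only: Lp_norm_uminus)
  qed
  ultimately have "(\<lambda>N::nat. Lp_norm unit_interval 2 (\<lambda>x. (estimator I w \<beta> Q J y \<omega> x - f x) -
      (\<Sum>j\<in>{-1..int N}. \<Sum>k\<in>I j.
        ((if j \<le> J then clipped_coef \<beta> Q j (y j k \<omega>) else 0) - d j k) * w j k x))) \<longlonglongrightarrow> 0"
    by (rule Lim_transform_eventually)
  with sq show ?thesis
    by (simp add: wavelet_series_def)
qed

text \<open>Levels up to \<open>L\<close> are charged to the noise. Levels above \<open>L\<close>,
  whether clipped or omitted from the estimator, are charged to the coefficient bound, which needs
  no averaging.\<close>

lemma estimator_risk_bound:
  fixes \<beta> Q N l K \<Gamma> C :: real and L J :: int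
  assumes \<beta>: "0 < \<beta>" and Q: "0 < Q" and p: "1 \<le> p" and n: "1 \<le> n"
    and onb: "orthonormal_basis unit_interval (SIGMA j:{-1..}. I j) (\<lambda>(j, k). w j k)"
    and fin: "\<forall>j \<ge> -1. finite (I j)"
    and card: "\<And>j. j \<ge> -1 \<Longrightarrow> real (card (I j)) \<le> \<Gamma> * 2 powr real_of_int j" and \<Gamma>: "1 \<le> \<Gamma>"
    and ineq: "\<And>d f. wavelet_series I w d f \<Longrightarrow> Lp_norm unit_interval p f \<le> ennreal C *
      (\<Sum>i. let j = int i - 1 in ennreal (2 powr (of_int j * (1 / 2 - inv_exponent p))) *
         Lp_norm (count_space (I j)) p (d j))"
    and model: "white_noise_model n P Y" and coefs: "empirical_coefs I w P Y y"
    and LJ: "L \<le> J" and l: "1 \<le> l" and Ll: "p = \<infinity> \<Longrightarrow> 2 powr L * exp (- (3 / 2) * l\<^sup>2) \<le> 1"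
    and N: "N powr (- (1 / 2)) = 1 / sqrt (real n) * (if p = \<infinity> then l else 1)"
    and K: "K = (if p = \<infinity> then 2 + 2 * \<Gamma>
      else 1 + enn2real p powr enn2real p * (\<Gamma> * (2 * exp (1 / 2))))"
    and f: "f \<in> parameter_space I w \<beta> Q"
  shows "(\<integral>\<^sup>+ \<omega>. Lp_norm unit_interval p (\<lambda>x. estimator I w \<beta> Q J y \<omega> x - f x) \<partial>P f) \<le>
    ennreal C * (\<Sum>i. let j = int i - 1 in ennreal
      (if j \<le> L then K * (2 powr (j / 2) * N powr (- (1 / 2))) else 2 * \<Gamma> * Q * 2 powr (- \<beta> * j)))"
proof -
  obtain d where series: "wavelet_series I w d f"
    and d: "\<And>j k. j \<ge> -1 \<Longrightarrow> k \<in> I j \<Longrightarrow> \<bar>d j k\<bar> \<le> coef_bound \<beta> Q j"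
    using f unfolding parameter_space_def by blast
  have f_sq: "f \<in> square_integrable unit_interval"
    using series by (simp add: wavelet_series_def)
  have bm: "brownian_motion (P f) (\<lambda>t \<omega>. sqrt (real n) * (Y t \<omega> - (\<integral>u. f u \<partial>lebesgue_on {0..t})))"
    using model f_sq by (simp add: white_noise_model_def)
  have M: "prob_space (P f)"
    using bm by (simp add: brownian_motion_def)
  have w: "w j k \<in> square_integrable unit_interval" "(\<integral>x. (w j k x)\<^sup>2 \<partial>unit_interval) = 1"
    if "j \<ge> -1" "k \<in> I j" for j k
    using onb that by (auto simp: orthonormal_basis_def power2_eq_square)
  have y: "stochastic_integral (P f) Y (w j k) (y j k)" if "j \<ge> -1" "k \<in> I j" for j k
    using coefs f_sq that by (simp add: empirical_coefs_def)
  note ip = inv_exponent_bounds[OF p]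
  define e where "e \<omega> j k = (if j \<le> J then clipped_coef \<beta> Q j (y j k \<omega>) else 0) - d j k" for \<omega> j k
  define weight where "weight j = 2 powr (of_int j * (1 / 2 - inv_exponent p))" for j :: int
  define b where "b j = (if j \<le> L then K * (2 powr (j / 2) * N powr (- (1 / 2)))
    else 2 * \<Gamma> * Q * 2 powr (- \<beta> * j))" for j :: int
  \<comment> \<open>The weight of the norm inequality cancels the factor that the size of a level
    contributes to its norm, and the exponent \<open>p\<close> drops out.\<close>
  have weight: "0 \<le> weight j" "weight j * (2 powr real_of_int j) powr inv_exponent p = 2 powr (j / 2)" for j
    by (simp_all add: weight_def powr_powr algebra_simps flip: powr_add)
  have "\<exists>G \<in> borel_measurable (P f).
      (\<forall>\<omega>. ennreal (weight j) * Lp_norm (count_space (I j)) p (e \<omega> j) \<le> G \<omega>) \<and>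
      (\<integral>\<^sup>+ \<omega>. G \<omega> \<partial>P f) \<le> ennreal (b j)" if j: "j \<ge> -1" for j
  proof (cases "j \<le> L")
    case True
    define Z where "Z k \<omega> = sqrt (real n) * \<bar>y j k \<omega> - d j k\<bar>" for k \<omega>
    have "\<exists>G \<in> borel_measurable (P f).
        (\<forall>\<omega>. Lp_norm (count_space (I j)) p (\<lambda>k. e \<omega> j k) \<le> G \<omega>) \<and>
        (\<integral>\<^sup>+ \<omega>. G \<omega> \<partial>P f) \<le> ennreal ((2 powr real_of_int j) powr inv_exponent p *
          (1 / sqrt (real n) * (if p = \<infinity> then l else 1)) * K)"
    proof (rule level_noise_bound[OF M _ p _ card[OF j] _ _ _ _ _ l _ K])
      show "Z k \<in> borel_measurable (P f)" if "k \<in> I j" for k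
      proof -
        have [measurable]: "y j k \<in> borel_measurable (P f)"
          using y[OF j that] by (simp add: stochastic_integral_def)
        show ?thesis
          unfolding Z_def by measurable
      qed
      \<comment> \<open>The coefficient \<open>d j k\<close> is rewritten as the integral of
        \<open>f\<close> against \<open>w j k\<close>, about which the noise is centred.\<close>
      show "(\<integral>\<^sup>+ \<omega>. ennreal (exp (c * Z k \<omega>)) \<partial>P f) \<le> ennreal (2 * exp (c\<^sup>2 / 2))" if "k \<in> I j" for k c
        unfolding Z_def wavelet_series_coefficient[OF series onb fin j that]
        by (rule stochastic_integral_exp_abs_moment[OF bm n f_sq w[OF j that] y[OF j that]])
      show "\<bar>e \<omega> j k\<bar> \<le> 1 / sqrt (real n) * Z k \<omega>" if "k \<in> I j" for k \<omega>
        using True LJ n clipped_coef_contract[OF d[OF j that]] by (simp add: e_def Z_def)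
      show "2 powr real_of_int j * exp (- (3 / 2) * l\<^sup>2) \<le> 1" if "p = \<infinity>"
      proof -
        have "2 powr real_of_int j * exp (- (3 / 2) * l\<^sup>2) \<le> 2 powr L * exp (- (3 / 2) * l\<^sup>2)"
          using True by (intro mult_right_mono powr_mono) auto
        with Ll[OF that] show ?thesis
          by linarith
      qed
    qed (use fin j \<Gamma> n in auto)
    then obtain G where G: "G \<in> borel_measurable (P f)"
        "\<And>\<omega>. Lp_norm (count_space (I j)) p (\<lambda>k. e \<omega> j k) \<le> G \<omega>"
        "(\<integral>\<^sup>+ \<omega>. G \<omega> \<partial>P f) \<le> ennreal ((2 powr real_of_int j) powr inv_exponent p * N powr (- (1 / 2)) * K)"
      unfolding N by blast
    have "(\<integral>\<^sup>+ \<omega>. ennreal (weight j) * G \<omega> \<partial>P f) = ennreal (weight j) * (\<integral>\<^sup>+ \<omega>. G \<omega> \<partial>P f)"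
      using G(1) by (rule nn_integral_cmult)
    also have "\<dots> \<le> ennreal (weight j) *
        ennreal ((2 powr real_of_int j) powr inv_exponent p * N powr (- (1 / 2)) * K)"
      by (intro mult_left_mono G) simp
    also have "\<dots> = ennreal (weight j * (2 powr real_of_int j) powr inv_exponent p * N powr (- (1 / 2)) * K)"
      using weight(1)[of j] by (simp add: mult.assoc flip: ennreal_mult')
    also have "\<dots> = ennreal (b j)"
      using True by (simp add: weight b_def mult_ac)
    finally show ?thesis
      using G by (intro bexI[of _ "\<lambda>\<omega>. ennreal (weight j) * G \<omega>"]) (auto intro: mult_left_mono)
  next
    case False
    have cb: "0 \<le> coef_bound \<beta> Q j"
      using Q by (simp add: coef_bound_def)
    \<comment> \<open>Between \<open>L\<close> and \<open>J\<close> both terms of the difference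
      obey the coefficient bound; above \<open>J\<close> only \<open>- d j k\<close>
      remains.\<close>
    have "\<bar>e \<omega> j k\<bar> \<le> 2 * coef_bound \<beta> Q j" if "k \<in> I j" for k \<omega>
      using d[OF j that] abs_clipped_coef_le[of Q \<beta> j "y j k \<omega>"] Q by (auto simp: e_def)
    then have "Lp_norm (count_space (I j)) p (e \<omega> j) \<le>
        ennreal ((\<Gamma> * 2 powr real_of_int j) powr inv_exponent p * (2 * coef_bound \<beta> Q j))" for \<omega>
      using \<Gamma> cb fin j by (intro Lp_norm_count_space_le_max p card) auto
    then have "ennreal (weight j) * Lp_norm (count_space (I j)) p (e \<omega> j) \<le> ennreal (weight j) *
        ennreal ((\<Gamma> * 2 powr real_of_int j) powr inv_exponent p * (2 * coef_bound \<beta> Q j))" for \<omega>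
      by (intro mult_left_mono) auto
    also have "ennreal (weight j) *
        ennreal ((\<Gamma> * 2 powr real_of_int j) powr inv_exponent p * (2 * coef_bound \<beta> Q j)) =
        ennreal (weight j * ((\<Gamma> * 2 powr real_of_int j) powr inv_exponent p * (2 * coef_bound \<beta> Q j)))"
      using weight(1)[of j] by (simp flip: ennreal_mult')
    also have "\<dots> \<le> ennreal (b j)"
    proof (rule ennreal_leI)
      have "weight j * ((\<Gamma> * 2 powr real_of_int j) powr inv_exponent p * (2 * coef_bound \<beta> Q j)) =
          \<Gamma> powr inv_exponent p * (weight j * (2 powr real_of_int j) powr inv_exponent p) * (2 * coef_bound \<beta> Q j)"
        using \<Gamma> by (simp add: powr_mult mult_ac)
      also have "\<dots> = \<Gamma> powr inv_exponent p * (2 * Q * 2 powr (- \<beta> * j))"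
        unfolding weight(2) by (simp add: coef_bound_def algebra_simps flip: powr_add)
      \<comment> \<open>As \<open>1 \<le> \<Gamma>\<close> and
        \<open>inv_exponent p \<le> 1\<close>, the constant can be freed from
        \<open>p\<close>.\<close>
      also have "\<dots> \<le> \<Gamma> powr 1 * (2 * Q * 2 powr (- \<beta> * j))"
        using \<Gamma> ip Q by (intro mult_right_mono powr_mono) auto
      also have "\<dots> = b j"
        using False \<Gamma> by (simp add: b_def)
      finally show "weight j * ((\<Gamma> * 2 powr real_of_int j) powr inv_exponent p *
          (2 * coef_bound \<beta> Q j)) \<le> b j" .
    qed
    \<comment> \<open>The bound is deterministic, so a constant majorant serves, and its integral
      over a probability space is the constant itself.\<close>
    finally show ?thesis
      using prob_space.emeasure_space_1[OF M] by (intro bexI[of _ "\<lambda>_. ennreal (b j)"]) auto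
  qed
  then have "\<forall>i::nat. \<exists>G \<in> borel_measurable (P f).
      (\<forall>\<omega>. ennreal (weight (int i - 1)) * Lp_norm (count_space (I (int i - 1))) p (e \<omega> (int i - 1)) \<le> G \<omega>) \<and>
      (\<integral>\<^sup>+ \<omega>. G \<omega> \<partial>P f) \<le> ennreal (b (int i - 1))"
    by simp
  then obtain G where G: "\<And>i::nat. G i \<in> borel_measurable (P f)"
      "\<And>i \<omega>. ennreal (weight (int i - 1)) *
        Lp_norm (count_space (I (int i - 1))) p (e \<omega> (int i - 1)) \<le> G i \<omega>"
      "\<And>i. (\<integral>\<^sup>+ \<omega>. G i \<omega> \<partial>P f) \<le> ennreal (b (int i - 1))"
    by metis
  have "(\<integral>\<^sup>+ \<omega>. Lp_norm unit_interval p (\<lambda>x. estimator I w \<beta> Q J y \<omega> x - f x) \<partial>P f) \<le>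
      (\<integral>\<^sup>+ \<omega>. ennreal C * (\<Sum>i. G i \<omega>) \<partial>P f)"
  proof (rule nn_integral_mono)
    fix \<omega>
    have "Lp_norm unit_interval p (\<lambda>x. estimator I w \<beta> Q J y \<omega> x - f x) \<le> ennreal C *
        (\<Sum>i. let j = int i - 1 in ennreal (2 powr (of_int j * (1 / 2 - inv_exponent p))) *
          Lp_norm (count_space (I j)) p (e \<omega> j))"
      unfolding e_def by (rule ineq[OF wavelet_series_estimation_error[OF series onb]])
    also have "\<dots> \<le> ennreal C * (\<Sum>i. G i \<omega>)"
      by (intro mult_left_mono suminf_le) (use G(2) in \<open>auto simp: Let_def weight_def\<close>)
    finally show "Lp_norm unit_interval p (\<lambda>x. estimator I w \<beta> Q J y \<omega> x - f x) \<le>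
        ennreal C * (\<Sum>i. G i \<omega>)" .
  qed
  \<comment> \<open>Monotone convergence for nonnegative series, applied to the measurable
    majorants.\<close>
  also have "\<dots> = ennreal C * (\<Sum>i. \<integral>\<^sup>+ \<omega>. G i \<omega> \<partial>P f)"
    using G(1) by (simp add: nn_integral_cmult nn_integral_suminf)
  also have "\<dots> \<le> ennreal C * (\<Sum>i. ennreal (b (int i - 1)))"
    by (intro mult_left_mono suminf_le G) auto
  finally show ?thesis
    by (simp add: b_def Let_def)
qed

section \<open>The rate, uniformly over the parameter space\<close>

theorem theorem1:
  fixes \<beta> Q :: real and p :: ennreal and s :: nat
    and \<phi> \<psi> :: "real \<Rightarrow> real"
    and I :: "int \<Rightarrow> int set" and w :: "int \<Rightarrow> int \<Rightarrow> real \<Rightarrow> real"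
    and P :: "nat \<Rightarrow> (real \<Rightarrow> real) \<Rightarrow> 'w measure"
    and Y :: "nat \<Rightarrow> real \<Rightarrow> 'w \<Rightarrow> real"
    and y :: "nat \<Rightarrow> int \<Rightarrow> int \<Rightarrow> 'w \<Rightarrow> real"
    and J :: "nat \<Rightarrow> int"
  assumes "0 < \<beta>" and "0 < Q" and "1 \<le> p"
    and "interval_wavelet_basis s \<phi> \<psi> I w"
    and "\<And>n. n \<ge> 1 \<Longrightarrow> white_noise_model n (P n) (Y n)"
    and "\<And>n. n \<ge> 1 \<Longrightarrow> empirical_coefs I w (P n) (Y n) (y n)"
    and "(\<lambda>n. 2 powr real_of_int (J n)) \<in> \<Theta>(\<lambda>n. real n powr (1 / (2 * \<beta> + 1)))"
  shows "limsup (\<lambda>n.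
           (SUP f\<in>parameter_space I w \<beta> Q.
              \<integral>\<^sup>+ \<omega>. Lp_norm unit_interval p (\<lambda>x. estimator I w \<beta> Q (J n) (y n) \<omega> x - f x) \<partial>P n f)
           / ennreal (minimax_rate \<beta> p n)) < \<infinity>"
proof -
  define \<gamma> where "\<gamma> = 1 / (2 * \<beta> + 1)"
  have \<gamma>: "0 < \<gamma>" "\<gamma> \<le> 1"
    using \<open>0 < \<beta>\<close> by (auto simp: \<gamma>_def)
  have fin: "\<forall>j \<ge> -1. finite (I j)"
    and onb: "orthonormal_basis unit_interval (SIGMA j:{-1..}. I j) (\<lambda>(j, k). w j k)"
    and size: "(\<lambda>j. real (card (I j))) \<in> \<Theta>[principal {-1..}](\<lambda>j. 2 powr real_of_int j)"
    using assms(4) by (simp_all add: interval_wavelet_basis_def)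
  obtain C where ineq: "\<And>d f. wavelet_series I w d f \<Longrightarrow> Lp_norm unit_interval p f \<le> ennreal C *
      (\<Sum>i. let j = int i - 1 in ennreal (2 powr (of_int j * (1 / 2 - inv_exponent p))) *
         Lp_norm (count_space (I j)) p (d j))"
    using assms(3,4) unfolding interval_wavelet_basis_def by blast
  obtain \<Gamma> where \<Gamma>: "1 \<le> \<Gamma>"
    and card: "\<And>j. j \<ge> -1 \<Longrightarrow> real (card (I j)) \<le> \<Gamma> * 2 powr real_of_int j"
  proof -
    \<comment> \<open>On a principal filter an eventual bound holds at every level
      \<open>j \<ge> -1\<close>. Enlarging the constant to at least 1 makes its powers monotone in
      the exponent.\<close>
    from bigthetaD1[OF size] obtain c where
      c: "\<And>j. j \<ge> -1 \<Longrightarrow> real (card (I j)) \<le> c * 2 powr real_of_int j"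
      by (elim landau_o.bigE) (auto simp: eventually_principal)
    show thesis
    proof (rule that[of "max 1 c"])
      fix j :: int assume "j \<ge> -1"
      note c[OF this]
      also have "c * 2 powr real_of_int j \<le> max 1 c * 2 powr real_of_int j"
        by (intro mult_right_mono) auto
      finally show "real (card (I j)) \<le> max 1 c * 2 powr real_of_int j" .
    qed simp
  qed
  \<comment> \<open>The estimator has enough levels for a balancing level of order
    \<open>N powr \<gamma>\<close> to be found at or below \<open>J n\<close>.\<close>
  obtain c where c: "0 < c" and J: "\<forall>\<^sub>F n in sequentially. c * real n powr \<gamma> \<le> 2 powr real_of_int (J n)"
    using bigthetaD2[OF assms(7)]
    by (elim landau_omega.bigE) (auto simp: \<gamma>_def)
  define K where "K = (if p = \<infinity> then 2 + 2 * \<Gamma>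
    else 1 + enn2real p powr enn2real p * (\<Gamma> * (2 * exp (1 / 2))))"
  have K: "0 \<le> K"
    using \<Gamma> by (simp add: K_def)
  define c' where "c' = min c (1 / 2)"
  define q where "q = max (2 powr (- (1 / 2))) (2 powr (- \<beta>))"
  \<comment> \<open>The constant of \<open>suminf_rate_bound\<close> with
    \<open>K' = 2 * \<Gamma> * Q\<close>; it depends neither on \<open>n\<close> nor on
    \<open>f\<close>.\<close>
  define B where "B = max K (2 * \<Gamma> * Q * c' powr (- \<beta>)) * (2 / (1 - q))"
  have c': "0 < c'"
    using c by (simp add: c'_def)
  have "\<forall>\<^sub>F n in sequentially.
      (SUP f\<in>parameter_space I w \<beta> Q.
        \<integral>\<^sup>+ \<omega>. Lp_norm unit_interval p (\<lambda>x. estimator I w \<beta> Q (J n) (y n) \<omega> x - f x) \<partial>P n f)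
      / ennreal (minimax_rate \<beta> p n) \<le> ennreal C * ennreal B"
    \<comment> \<open>From 3 on, \<open>exp 1 \<le> n\<close> and thus \<open>1 \<le> ln n\<close>,
      which is used for \<open>1 \<le> l\<close> and \<open>N \<le> n\<close>.\<close>
    using J eventually_ge_at_top[of 3]
  proof eventually_elim
    case (elim n)
    then have n: "3 \<le> n" "1 \<le> n"
      by auto
    define N where "N = (if p = \<infinity> then real n / ln (real n) else real n)"
    define l where "l = sqrt (ln (real n))"
    have ln_n: "1 \<le> ln (real n)"
    proof -
      have "exp 1 \<le> real n"
        using exp_le n by linarith
      with n show ?thesis
        by (subst ln_ge_iff) auto
    qed
    have "ln (real n) \<le> real n"
      using ln_le_minus_one[of "real n"] n by simp
    then have N: "1 \<le> N" "N \<le> real n"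
      using ln_n n by (auto simp: N_def divide_le_eq)
    obtain L where L: "L \<le> J n" "2 powr L \<le> N powr \<gamma>" "c' * N powr \<gamma> \<le> 2 powr (real_of_int L)"
      using threshold_level_exists[OF N \<gamma>(1) c elim(1)] unfolding c'_def by blast
    have l: "1 \<le> l"
      using ln_n by (simp add: l_def)
    \<comment> \<open>With \<open>l\<^sup>2 = ln n\<close> the exponential is
      \<open>n powr (- 3 / 2)\<close>, which outweighs \<open>2 powr L \<le> n powr \<gamma>\<close>
      because \<open>\<gamma> \<le> 1\<close>.\<close>
    have noise: "2 powr L * exp (- (3 / 2) * l\<^sup>2) \<le> 1"
    proof -
      have "2 powr L \<le> real n powr \<gamma>"
        using L(2) N \<gamma> powr_mono2[of \<gamma> N "real n"] by simp
      also have "\<dots> \<le> real n powr (3 / 2)"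
        using n \<gamma> by (intro powr_mono) auto
      also have "\<dots> = exp (3 / 2 * l\<^sup>2)"
        using n ln_n by (simp add: powr_def l_def)
      finally have "2 powr L * exp (- (3 / 2) * l\<^sup>2) \<le> exp (3 / 2 * l\<^sup>2) * exp (- (3 / 2) * l\<^sup>2)"
        by (intro mult_right_mono) auto
      then show ?thesis
        by (simp flip: exp_add)
    qed
    have N_half: "N powr (- (1 / 2)) = 1 / sqrt (real n) * (if p = \<infinity> then l else 1)"
    proof -
      have "N powr (- (1 / 2)) = 1 / sqrt N"
        using N by (simp add: powr_minus_divide powr_half_sqrt)
      then show ?thesis
        by (simp add: N_def l_def real_sqrt_divide)
    qed
    have rate: "minimax_rate \<beta> p n = N powr (- \<beta> / (2 * \<beta> + 1))"
      by (simp add: minimax_rate_def N_def)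
    have "(\<integral>\<^sup>+ \<omega>. Lp_norm unit_interval p (\<lambda>x. estimator I w \<beta> Q (J n) (y n) \<omega> x - f x) \<partial>P n f) \<le>
        ennreal C * ennreal (B * minimax_rate \<beta> p n)" if "f \<in> parameter_space I w \<beta> Q" for f
    proof -
      have "(\<integral>\<^sup>+ \<omega>. Lp_norm unit_interval p (\<lambda>x. estimator I w \<beta> Q (J n) (y n) \<omega> x - f x) \<partial>P n f) \<le>
          ennreal C * (\<Sum>i. let j = int i - 1 in ennreal (if j \<le> L
            then K * (2 powr (j / 2) * N powr (- (1 / 2))) else 2 * \<Gamma> * Q * 2 powr (- \<beta> * j)))"
        by (rule estimator_risk_bound[OF assms(1-3) n(2) onb fin card \<Gamma> ineq assms(5)[OF n(2)]
            assms(6)[OF n(2)] L(1) l noise N_half K_def that])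
      also have "\<dots> \<le> ennreal C * ennreal (B * minimax_rate \<beta> p n)"
        unfolding rate B_def
        by (intro mult_left_mono suminf_rate_bound[OF \<open>0 < \<beta>\<close> N(1) c' K _ _ _ q_def])
          (use L(2,3) \<Gamma> \<open>0 < Q\<close> in \<open>auto simp: \<gamma>_def\<close>)
      finally show ?thesis .
    qed
    then have "(SUP f\<in>parameter_space I w \<beta> Q.
        \<integral>\<^sup>+ \<omega>. Lp_norm unit_interval p (\<lambda>x. estimator I w \<beta> Q (J n) (y n) \<omega> x - f x) \<partial>P n f)
        \<le> ennreal C * ennreal (B * minimax_rate \<beta> p n)"
      by (rule SUP_least)
    then have "(SUP f\<in>parameter_space I w \<beta> Q.
        \<integral>\<^sup>+ \<omega>. Lp_norm unit_interval p (\<lambda>x. estimator I w \<beta> Q (J n) (y n) \<omega> x - f x) \<partial>P n f)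
        / ennreal (minimax_rate \<beta> p n)
        \<le> ennreal C * ennreal (B * minimax_rate \<beta> p n) / ennreal (minimax_rate \<beta> p n)"
      by (rule divide_right_mono_ennreal)
    \<comment> \<open>Cancelling in \<open>ennreal\<close> requires a divisor that is neither zero
      nor infinite; \<open>1 \<le> N\<close> makes the rate positive.\<close>
    also have "\<dots> = ennreal C * ennreal B"
    proof -
      have pos: "0 < minimax_rate \<beta> p n"
        using N by (simp add: rate)
      have "ennreal (B * minimax_rate \<beta> p n) = ennreal B * ennreal (minimax_rate \<beta> p n)"
        using pos by (intro ennreal_mult'') simp
      then show ?thesis
        using pos by (simp add: ennreal_mult_divide_eq flip: mult.assoc)
    qed
    finally show ?case .
  qed
  then have "limsup (\<lambda>n. (SUP f\<in>parameter_space I w \<beta> Q.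
        \<integral>\<^sup>+ \<omega>. Lp_norm unit_interval p (\<lambda>x. estimator I w \<beta> Q (J n) (y n) \<omega> x - f x) \<partial>P n f)
      / ennreal (minimax_rate \<beta> p n)) \<le> ennreal C * ennreal B"
    by (rule Limsup_bounded)
  also have "\<dots> < \<infinity>"
    by (simp add: ennreal_mult_less_top)
  finally show ?thesis .
qed

end
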